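(* Let $n$ be a positive integer. Then $n=\frac{x(x-1)}2+\frac{y(y-1)}2+8\frac{z(z-1)}2$ for some $x,y,z\in\mathbb Z$ if and only if either $4n+5$ is not a perfect square or $4n+5$ has a prime divisor of the form $4k+3$. *)

theory Defs
  imports Complex_Main "HOL-Computational_Algebra.Primes"
begin

end

theory Submission
  imports Defs "HOL-Number_Theory.Residues"
begin

text \<open>
  Put \<open>m = 4 * n + 5\<close>. Completing squares, \<open>n\<close> has the required form iff
  \<open>m = a\<^sup>2 + 4 * b\<^sup>2 + 4 * c\<^sup>2\<close> with \<open>a\<close> and \<open>c\<close> odd.

  Every \<open>m \<equiv> 1 (mod 4)\<close> is \<open>x\<^sup>2 + y\<^sup>2 + z\<^sup>2\<close> with \<open>x\<close> odd and \<open>y\<close>, \<open>z\<close> even: the number of these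
  representations is twice the number of forms \<open>a * b - w\<^sup>2 = m\<close> with \<open>\<bar>w\<bar> < a\<close>, \<open>\<bar>w\<bar> < b\<close> (\<open>a\<close>, \<open>b\<close> odd,
  \<open>w\<close> even), of which \<open>(1, m, 0)\<close> is one. Indeed, both counts are determined by their sums over \<open>m - i\<^sup>2\<close> with
  \<open>i\<close> even, and these sums are \<open>2 * \<sigma>(m)\<close> by Jacobi's four-square theorem and \<open>\<sigma>(m)\<close> by a count of
  integer matrices of determinant \<open>m\<close>. This settles even \<open>n\<close>, where \<open>m \<equiv> 5 (mod 8)\<close>.

  For \<open>m \<equiv> 1 (mod 8)\<close> one needs \<open>m = x\<^sup>2 + 8 * (p\<^sup>2 + q\<^sup>2)\<close> with \<open>p + q\<close> odd. Some representation exists by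
  three squares, and the sum of \<open>(-1)\<close> to the power \<open>p + q\<close> over all of them is \<open>0\<close> if \<open>m\<close> is not a square
  and \<open>- 2 * s\<close> if \<open>m = s\<^sup>2\<close> with \<open>s \<equiv> 3 (mod 4)\<close>; so odd \<open>p + q\<close> occurs. If \<open>m = s\<^sup>2\<close> and a prime
  \<open>l \<equiv> 3 (mod 4)\<close> divides \<open>s\<close>, scale a representation of \<open>l\<^sup>2\<close>. If there is no such prime, then factoring
  \<open>s\<^sup>2 - x\<^sup>2\<close> gives \<open>s = 2 * A + B\<close> with \<open>A * B = p\<^sup>2 + q\<^sup>2\<close> odd, which forces \<open>A \<equiv> B \<equiv> 1\<close> and
  \<open>s \<equiv> 3 (mod 4)\<close>, a contradiction.

  The theta function identities behind the two- and four-square theorems and the signed count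
  are all instances of one finite identity of Liouville.
\<close>

section \<open>Liouville's identity\<close>

text \<open>The non-principal Dirichlet character modulo 4.\<close>

definition chi :: "int \<Rightarrow> int" where
  "chi x = (if x mod 4 = 1 then 1 else if x mod 4 = 3 then -1 else 0)"

definition sg :: "int \<Rightarrow> int" where
  "sg k = (if even k then 1 else -1)"

definition divisor_pairs :: "int \<Rightarrow> (int \<times> int) set" where
  "divisor_pairs n = {(d, e). 0 < d \<and> 0 < e \<and> d * e = n}"

text \<open>The triple \<open>(X, d, e)\<close> stands for the form d u^2 + X u v - e v^2 of
  discriminant \<open>N\<close>. The bijections in the identity below are changes of variables on
  these forms, up to sign, and its case splits are on the signs of the values at (1, 1) and (1,
  -1).\<close>

definition liouville_set :: "int \<Rightarrow> (int \<times> int \<times> int) set" where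
  "liouville_set N = {(X, d, e). 0 < d \<and> 0 < e \<and> X\<^sup>2 + 4 * d * e = N}"

lemma sg_add: "sg (a + b) = sg a * sg b" by (auto simp: sg_def)
lemma sg_diff: "sg (a - b) = sg a * sg b" by (auto simp: sg_def)
lemma sg_minus [simp]: "sg (- a) = sg a" by (auto simp: sg_def)
lemma sg_square [simp]: "sg a * sg a = 1" by (auto simp: sg_def)
lemma sg_power2 [simp]: "sg (a\<^sup>2) = sg a" by (auto simp: sg_def)

lemma chi_minus [simp]: "chi (- x) = - chi x"
  unfolding chi_def by presburger

lemma chi_even: "even x \<Longrightarrow> chi x = 0"
  unfolding chi_def by presburger

lemma chi_add_double: "chi (x + 2 * k) = sg k * chi x"
  unfolding chi_def sg_def by presburger

lemma abs_le_power2: "\<bar>x\<bar> \<le> x\<^sup>2" for x :: int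
proof (cases "x = 0")
  case False
  then have "\<bar>x\<bar> * 1 \<le> \<bar>x\<bar> * \<bar>x\<bar>" by (intro mult_left_mono) auto
  then show ?thesis by (simp add: power2_eq_square)
qed simp

lemma finite_liouville_set: "finite (liouville_set N)"
proof (rule finite_subset)
  show "liouville_set N \<subseteq> {-N..N} \<times> {0..N} \<times> {0..N}"
  proof
    fix t assume "t \<in> liouville_set N"
    then obtain X d e where t: "t = (X, d, e)" "0 < d" "0 < e" "X\<^sup>2 + 4 * (d * e) = N"
      by (auto simp: liouville_set_def)
    then have "d * 1 \<le> d * e" "1 * e \<le> d * e"
      by (intro mult_left_mono mult_right_mono; simp)+
    then have "- N \<le> X" "X \<le> N" "d \<le> N" "e \<le> N"
      using t abs_le_power2[of X] by linarith+
    then show "t \<in> {-N..N} \<times> {0..N} \<times> {0..N}" using t by simp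
  qed
qed simp

lemma finite_divisor_pairs: "finite (divisor_pairs n)"
proof (rule finite_subset)
  show "divisor_pairs n \<subseteq> {0..n} \<times> {0..n}"
  proof
    fix t assume "t \<in> divisor_pairs n"
    then obtain d e where t: "t = (d, e)" "0 < d" "0 < e" "d * e = n"
      by (auto simp: divisor_pairs_def)
    then have "d * 1 \<le> d * e" "1 * e \<le> d * e"
      by (intro mult_left_mono mult_right_mono; simp)+
    then show "t \<in> {0..n} \<times> {0..n}" using t by simp
  qed
qed simp

lemma divisor_pairs_nonpos: "n \<le> 0 \<Longrightarrow> divisor_pairs n = {}"
  by (auto simp: divisor_pairs_def) (smt (verit) mult_pos_pos)

lemma sum_liouville_split:
  fixes f :: "int \<times> int \<times> int \<Rightarrow> int" and g :: "int \<times> int \<times> int \<Rightarrow> int"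
  shows "sum f (liouville_set N) = sum f {t \<in> liouville_set N. g t < 0}
    + sum f {t \<in> liouville_set N. g t = 0} + sum f {t \<in> liouville_set N. 0 < g t}"
proof -
  have "liouville_set N = ({t \<in> liouville_set N. g t < 0} \<union> {t \<in> liouville_set N. g t = 0})
      \<union> {t \<in> liouville_set N. 0 < g t}" by auto
  then have "sum f (liouville_set N) = sum f (({t \<in> liouville_set N. g t < 0} \<union> {t \<in> liouville_set N. g t = 0})
      \<union> {t \<in> liouville_set N. 0 < g t})" by simp
  also have "\<dots> = sum f ({t \<in> liouville_set N. g t < 0} \<union> {t \<in> liouville_set N. g t = 0})
      + sum f {t \<in> liouville_set N. 0 < g t}"
    by (rule sum.union_disjoint) (auto simp: finite_liouville_set)
  also have "sum f ({t \<in> liouville_set N. g t < 0} \<union> {t \<in> liouville_set N. g t = 0})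
      = sum f {t \<in> liouville_set N. g t < 0} + sum f {t \<in> liouville_set N. g t = 0}"
    by (rule sum.union_disjoint) (auto simp: finite_liouville_set)
  finally show ?thesis .
qed

text \<open>On the left, where e - X < d, an involution negates e - X and fixes the other two
  arguments of \<open>F\<close>, so these terms cancel by oddness. Where e - X > d, a shift carries
  the left summand to the right one on e + X > d; by evenness this is half of the right sum without
  its boundary d = e + X. The boundary terms are the two corrections.\<close>

theorem liouville_identity:
  fixes F :: "int \<Rightarrow> int \<Rightarrow> int \<Rightarrow> int"
  assumes odd: "\<And>x w z. F (- x) w z = - F x w z"
    and even: "\<And>x w z. F x (- w) (- z) = F x w z"
  shows "2 * (\<Sum>(X, d, e) \<in> liouville_set N. F (e - X) (2 * d + X) (2 * d + X - e))
    = (\<Sum>(X, d, e) \<in> liouville_set N. F (d + e) X (d - e))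
      + 2 * (\<Sum>(X, d, e) \<in> {(X, d, e) \<in> liouville_set N. e = d + X}. F d (2 * d + X) d)
      - (\<Sum>(X, d, e) \<in> {(X, d, e) \<in> liouville_set N. d = e + X}. F (d + e) X (d - e))"
proof -
  let ?L = "liouville_set N"
  let ?f = "\<lambda>(X, d, e). F (e - X) (2 * d + X) (2 * d + X - e)"
  let ?g = "\<lambda>(X, d, e). F (d + e) X (d - e)"
  let ?u = "\<lambda>(X, d, e). e - X - d :: int"
  let ?v = "\<lambda>(X, d, e). e + X - d :: int"
  have neg: "sum ?f {t \<in> ?L. ?u t < 0} = 0"
  proof -
    have "sum ?f {t \<in> ?L. ?u t < 0} = sum (\<lambda>t. - ?f t) {t \<in> ?L. ?u t < 0}"
    proof (rule sum.reindex_bij_witness[where i = "\<lambda>(X, d, e). (2 * e - X, d + X - e, e)"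
          and j = "\<lambda>(X, d, e). (2 * e - X, d + X - e, e)"], goal_cases)
      case (5 t)
      obtain X d e where t: "t = (X, d, e)" by (cases t)
      have "F (- (e - X)) (2 * d + X) (2 * d + X - e) = - F (e - X) (2 * d + X) (2 * d + X - e)"
        by (rule odd)
      then show ?case by (simp add: t algebra_simps)
    qed (auto simp: liouville_set_def power2_eq_square algebra_simps)
    then show ?thesis by (simp add: sum_negf)
  qed
  \<comment> \<open>The inequality on the target is the positivity of the old \<open>e\<close>, and
    the inequality on the source is the positivity of the new one.\<close>
  have pos: "sum ?f {t \<in> ?L. 0 < ?u t} = sum ?g {t \<in> ?L. 0 < ?v t}"
    by (rule sum.reindex_bij_witness[where j = "\<lambda>(X, d, e). (X + 2 * d, d, e - X - d)"
          and i = "\<lambda>(X, d, e). (X - 2 * d, d, e + X - d)"])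
      (auto simp: liouville_set_def power2_eq_square algebra_simps)
  have swap: "sum ?g {t \<in> ?L. ?v t < 0} = sum ?g {t \<in> ?L. 0 < ?v t}"
  proof (rule sum.reindex_bij_witness[where j = "\<lambda>(X, d, e). (- X, e, d)"
          and i = "\<lambda>(X, d, e). (- X, e, d)"], goal_cases)
    case (5 t)
    obtain X d e where t: "t = (X, d, e)" by (cases t)
    have "F (d + e) (- X) (- (d - e)) = F (d + e) X (d - e)" by (rule even)
    then show ?case by (simp add: t algebra_simps)
  qed (auto simp: liouville_set_def power2_eq_square algebra_simps)
  have eq1: "sum ?f {t \<in> ?L. ?u t = 0}
      = (\<Sum>(X, d, e) \<in> {(X, d, e) \<in> ?L. e = d + X}. F d (2 * d + X) d)"
    by (rule sum.cong) (auto simp: algebra_simps)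
  have eq2: "sum ?g {t \<in> ?L. ?v t = 0} = sum ?g {(X, d, e) \<in> ?L. d = e + X}"
    by (rule sum.cong) (auto simp: algebra_simps)
  show ?thesis
    using sum_liouville_split[of ?f N ?u] sum_liouville_split[of ?g N ?v] neg pos swap eq1 eq2
    by linarith
qed

text \<open>Boundary terms satisfy (d + e)^2 = s^2, hence d + e = s, which leaves one free index j
  with 0 < j < s: \<open>d\<close> in the first correction and \<open>e\<close> in the
  second.\<close>

lemma liouville_square:
  fixes F :: "int \<Rightarrow> int \<Rightarrow> int \<Rightarrow> int"
  assumes "\<And>x w z. F (- x) w z = - F x w z" "\<And>x w z. F x (- w) (- z) = F x w z" "0 < s"
  shows "2 * (\<Sum>(X, d, e) \<in> liouville_set (s\<^sup>2). F (e - X) (2 * d + X) (2 * d + X - e))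
    = (\<Sum>(X, d, e) \<in> liouville_set (s\<^sup>2). F (d + e) X (d - e))
      + 2 * (\<Sum>j \<in> {0<..<s}. F j s j) - (\<Sum>j \<in> {0<..<s}. F s (s - 2 * j) (s - 2 * j))"
proof -
  have sq: "d + e = s" if "X\<^sup>2 + 4 * d * e = s\<^sup>2" "e = d + X \<or> d = e + X" "0 < d" "0 < e" for X d e
  proof -
    have "(d + e)\<^sup>2 = s\<^sup>2" using that(1,2) by (auto simp: power2_eq_square algebra_simps)
    then show ?thesis using that assms(3) by (simp add: power2_eq_iff)
  qed
  have 1: "(\<Sum>(X, d, e) \<in> {(X, d, e) \<in> liouville_set (s\<^sup>2). e = d + X}. F d (2 * d + X) d)
      = (\<Sum>j \<in> {0<..<s}. F j s j)"
  proof (rule sum.reindex_bij_witness[where i = "\<lambda>j. (s - 2 * j, j, s - j)" and j = "\<lambda>(X, d, e). d"],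
      goal_cases)
    case (1 t) then show ?case using sq by (fastforce simp: liouville_set_def)
  next
    case (2 t) then show ?case using sq by (fastforce simp: liouville_set_def)
  next
    case (5 t) then show ?case using sq by (fastforce simp: liouville_set_def)
  qed (auto simp: liouville_set_def power2_eq_square algebra_simps)
  have 2: "(\<Sum>(X, d, e) \<in> {(X, d, e) \<in> liouville_set (s\<^sup>2). d = e + X}. F (d + e) X (d - e))
      = (\<Sum>j \<in> {0<..<s}. F s (s - 2 * j) (s - 2 * j))"
  proof (rule sum.reindex_bij_witness[where i = "\<lambda>j. (s - 2 * j, s - j, j)" and j = "\<lambda>(X, d, e). e"],
      goal_cases)
    case (1 t)
    obtain X d e where t: "t = (X, d, e)" by (cases t)
    with 1 have "d = e + X" "d + e = s" using sq[of X d e] by (auto simp: liouville_set_def)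
    then have "X = s - 2 * e" "d = s - e" by linarith+
    then show ?case using t by simp
  next
    case (2 t)
    then show ?case using sq by (force simp: liouville_set_def)
  next
    case (5 t)
    obtain X d e where t: "t = (X, d, e)" by (cases t)
    with 5 have "d = e + X" "d + e = s" using sq[of X d e] by (auto simp: liouville_set_def)
    then have "X = s - 2 * e" "d - e = s - 2 * e" "d + e = s" by linarith+
    then show ?case unfolding t prod.case by (simp only:)
  qed (auto simp: liouville_set_def power2_eq_square algebra_simps)
  show ?thesis using liouville_identity[of F "s\<^sup>2"] assms(1,2) 1 2 by simp
qed

text \<open>Either boundary equation would make \<open>N\<close> the square of d + e, so both
  corrections are empty.\<close>

lemma liouville_nonsquare:
  fixes F :: "int \<Rightarrow> int \<Rightarrow> int \<Rightarrow> int"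
  assumes "\<And>x w z. F (- x) w z = - F x w z" "\<And>x w z. F x (- w) (- z) = F x w z"
    and "\<And>s. N \<noteq> s\<^sup>2"
  shows "2 * (\<Sum>(X, d, e) \<in> liouville_set N. F (e - X) (2 * d + X) (2 * d + X - e))
    = (\<Sum>(X, d, e) \<in> liouville_set N. F (d + e) X (d - e))"
proof -
  have sq: False if "X\<^sup>2 + 4 * d * e = N" "e = d + X \<or> d = e + X" for X d e
  proof -
    have "(d + e)\<^sup>2 = N" using that(1,2) by (auto simp: power2_eq_square algebra_simps)
    then show ?thesis using assms(3) by metis
  qed
  have 1: "{(X, d, e) \<in> liouville_set N. e = d + X} = {}" "{(X, d, e) \<in> liouville_set N. d = e + X} = {}"
    using sq by (auto simp: liouville_set_def)
  show ?thesis using liouville_identity[of F N] assms(1,2) unfolding 1 by simp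
qed

section \<open>Sums of two and four squares\<close>

lemma finite_sum_of_squares [simp]:
  "finite {(x, y). x\<^sup>2 + y\<^sup>2 = (k :: int)}"
  "finite {(x, y, z). x\<^sup>2 + y\<^sup>2 + z\<^sup>2 = (k :: int)}"
  "finite {(x, y, z, w). x\<^sup>2 + y\<^sup>2 + z\<^sup>2 + w\<^sup>2 = (k :: int)}"
  "finite {(x, y, z, w, v). x\<^sup>2 + y\<^sup>2 + z\<^sup>2 + w\<^sup>2 + v\<^sup>2 = (k :: int)}"
proof -
  have le: "x \<le> x\<^sup>2" "- x \<le> x\<^sup>2" "0 \<le> x\<^sup>2" for x :: int
    using abs_le_power2[of x] by linarith+
  have "x \<in> {-k..k} \<and> y \<in> {-k..k}"
    if "x\<^sup>2 + y\<^sup>2 = k" for x y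
    unfolding atLeastAtMost_iff using that le[of x] le[of y]
    by (intro conjI; linarith)
  then have "{(x, y). x\<^sup>2 + y\<^sup>2 = k} \<subseteq> {-k..k} \<times> {-k..k}"
    by auto
  then show "finite {(x, y). x\<^sup>2 + y\<^sup>2 = k}" by (rule finite_subset) simp
  have "x \<in> {-k..k} \<and> y \<in> {-k..k} \<and> z \<in> {-k..k}"
    if "x\<^sup>2 + y\<^sup>2 + z\<^sup>2 = k" for x y z
    unfolding atLeastAtMost_iff using that le[of x] le[of y] le[of z]
    by (intro conjI; linarith)
  then have "{(x, y, z). x\<^sup>2 + y\<^sup>2 + z\<^sup>2 = k} \<subseteq> {-k..k} \<times> {-k..k} \<times> {-k..k}"
    by auto
  then show "finite {(x, y, z). x\<^sup>2 + y\<^sup>2 + z\<^sup>2 = k}" by (rule finite_subset) simp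
  have "x \<in> {-k..k} \<and> y \<in> {-k..k} \<and> z \<in> {-k..k} \<and> w \<in> {-k..k}"
    if "x\<^sup>2 + y\<^sup>2 + z\<^sup>2 + w\<^sup>2 = k" for x y z w
    unfolding atLeastAtMost_iff using that le[of x] le[of y] le[of z] le[of w]
    by (intro conjI; linarith)
  then have "{(x, y, z, w). x\<^sup>2 + y\<^sup>2 + z\<^sup>2 + w\<^sup>2 = k} \<subseteq> {-k..k} \<times> {-k..k} \<times> {-k..k} \<times> {-k..k}"
    by auto
  then show "finite {(x, y, z, w). x\<^sup>2 + y\<^sup>2 + z\<^sup>2 + w\<^sup>2 = k}" by (rule finite_subset) simp
  have "x \<in> {-k..k} \<and> y \<in> {-k..k} \<and> z \<in> {-k..k} \<and> w \<in> {-k..k} \<and> v \<in> {-k..k}"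
    if "x\<^sup>2 + y\<^sup>2 + z\<^sup>2 + w\<^sup>2 + v\<^sup>2 = k" for x y z w v
    unfolding atLeastAtMost_iff using that le[of x] le[of y] le[of z] le[of w] le[of v]
    by (intro conjI; linarith)
  then have "{(x, y, z, w, v). x\<^sup>2 + y\<^sup>2 + z\<^sup>2 + w\<^sup>2 + v\<^sup>2 = k} \<subseteq> {-k..k} \<times> {-k..k} \<times> {-k..k} \<times> {-k..k} \<times> {-k..k}"
    by auto
  then show "finite {(x, y, z, w, v). x\<^sup>2 + y\<^sup>2 + z\<^sup>2 + w\<^sup>2 + v\<^sup>2 = k}" by (rule finite_subset) simp
qed

section \<open>Representation numbers and their recurrences\<close>

definition r2 :: "int \<Rightarrow> int" where
  "r2 k = int (card {(x, y). x\<^sup>2 + y\<^sup>2 = k})"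

definition r4 :: "int \<Rightarrow> int" where
  "r4 k = int (card {(x, y, z, w). x\<^sup>2 + y\<^sup>2 + z\<^sup>2 + w\<^sup>2 = k})"

lemma r2_neg: "k < 0 \<Longrightarrow> r2 k = 0"
  and r4_neg: "k < 0 \<Longrightarrow> r4 k = 0"
proof -
  assume k: "k < 0"
  have "x\<^sup>2 + y\<^sup>2 \<noteq> k" "x\<^sup>2 + y\<^sup>2 + z\<^sup>2 + w\<^sup>2 \<noteq> k" for x y z w :: int
    using k zero_le_power2[of x] zero_le_power2[of y] zero_le_power2[of z] zero_le_power2[of w]
    by linarith+
  then have "{(x, y). x\<^sup>2 + y\<^sup>2 = k} = {}" "{(x, y, z, w). x\<^sup>2 + y\<^sup>2 + z\<^sup>2 + w\<^sup>2 = k} = {}"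
    by blast+
  then show "r2 k = 0" "r4 k = 0" unfolding r2_def r4_def by (simp_all only: card.empty of_nat_0)
qed

lemma r2_0: "r2 0 = 1" and r4_0: "r4 0 = 1"
proof -
  have "x\<^sup>2 + y\<^sup>2 = 0 \<longleftrightarrow> x = 0 \<and> y = 0"
    "x\<^sup>2 + y\<^sup>2 + z\<^sup>2 + w\<^sup>2 = 0 \<longleftrightarrow> x = 0 \<and> y = 0 \<and> z = 0 \<and> w = 0" for x y z w :: int
    by (simp_all add: add_nonneg_eq_0_iff)
  then have "{(x, y). x\<^sup>2 + y\<^sup>2 = (0 :: int)} = {(0, 0)}"
    "{(x, y, z, w). x\<^sup>2 + y\<^sup>2 + z\<^sup>2 + w\<^sup>2 = (0 :: int)} = {(0, 0, 0, 0)}"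
    by auto
  then show "r2 0 = 1" "r4 0 = 1" unfolding r2_def r4_def by simp_all
qed

lemma sum_fibre_card:
  fixes g :: "int \<Rightarrow> int" and S :: "int \<Rightarrow> 'a set" and A :: "(int \<times> 'a) set"
  assumes "finite I" "finite A" "A = Sigma I S"
  shows "(\<Sum>h \<in> I. g h * int (card (S h))) = (\<Sum>(h, t) \<in> A. g h)"
proof (cases)
  assume fin: "\<forall>h \<in> I. finite (S h)"
  have "(\<Sum>(h, t) \<in> A. g h) = (\<Sum>h \<in> I. \<Sum>t \<in> S h. g h)"
    unfolding assms(3) by (rule sum.Sigma[symmetric]) (use assms(1) fin in auto)
  then show ?thesis by (simp add: mult.commute)
next
  assume "\<not> (\<forall>h \<in> I. finite (S h))"
  then obtain h where h: "h \<in> I" "infinite (S h)" by auto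
  have "Pair h ` S h \<subseteq> A" using h assms(3) by auto
  then have "finite (Pair h ` S h)" using assms(2) by (rule finite_subset)
  then show ?thesis using h(2) by (auto dest: finite_imageD simp: inj_on_def)
qed

text \<open>
  The recurrence expresses that \<open>P = \<theta> ^ k\<close> satisfies \<open>\<theta> * P' = k * \<theta>' * P\<close>.
\<close>

lemma r2_recurrence:
  "(\<Sum>h \<in> {-n..n}. (n - 3 * h\<^sup>2) * r2 (n - h\<^sup>2)) = 0"
proof -
  let ?A = "{(h, x, y). h\<^sup>2 + x\<^sup>2 + y\<^sup>2 = n}"
  have b: "h \<in> {-n..n}" if "h\<^sup>2 + x\<^sup>2 + y\<^sup>2 = n" for h x y
    using that abs_le_power2[of h] zero_le_power2[of x] zero_le_power2[of y]
    unfolding atLeastAtMost_iff by linarith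
  have A: "?A = Sigma {-n..n} (\<lambda>h. {(x, y). x\<^sup>2 + y\<^sup>2 = n - h\<^sup>2})"
    using b by (auto simp: algebra_simps)
  have "(\<Sum>h \<in> {-n..n}. (n - 3 * h\<^sup>2) * r2 (n - h\<^sup>2)) = (\<Sum>(h, t) \<in> ?A. n - 3 * h\<^sup>2)"
    unfolding r2_def by (rule sum_fibre_card[OF _ _ A]) simp_all
  \<comment> \<open>With \<open>n\<close> replaced by the sum of the three squares the weight is x^2
    + y^2 - 2 h^2. It sums to zero because exchanging coordinates permutes the
    representations.\<close>
  also have "\<dots> = (\<Sum>(h, x, y) \<in> ?A. h\<^sup>2 + x\<^sup>2 + y\<^sup>2 - 3 * h\<^sup>2)"
    by (rule sum.cong) auto
  also have "\<dots> = (\<Sum>(h, x, y) \<in> ?A. x\<^sup>2) + (\<Sum>(h, x, y) \<in> ?A. y\<^sup>2) - 2 * (\<Sum>(h, x, y) \<in> ?A. h\<^sup>2)"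
    unfolding sum_distrib_left sum_subtractf[symmetric] sum.distrib[symmetric]
    by (rule sum.cong) auto
  also have "(\<Sum>(h, x, y) \<in> ?A. x\<^sup>2) = (\<Sum>(h, x, y) \<in> ?A. h\<^sup>2)"
    by (rule sum.reindex_bij_witness[where i = "\<lambda>(h, x, y). (x, h, y)" and j = "\<lambda>(h, x, y). (x, h, y)"]) auto
  also have "(\<Sum>(h, x, y) \<in> ?A. y\<^sup>2) = (\<Sum>(h, x, y) \<in> ?A. h\<^sup>2)"
    by (rule sum.reindex_bij_witness[where i = "\<lambda>(h, x, y). (y, x, h)" and j = "\<lambda>(h, x, y). (y, x, h)"]) auto
  finally show ?thesis by (simp add: case_prod_unfold)
qed

lemma r4_recurrence:
  "(\<Sum>h \<in> {-n..n}. (n - 5 * h\<^sup>2) * r4 (n - h\<^sup>2)) = 0"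
proof -
  let ?A = "{(h, x, y, z, w). h\<^sup>2 + x\<^sup>2 + y\<^sup>2 + z\<^sup>2 + w\<^sup>2 = n}"
  have b: "h \<in> {-n..n}" if "h\<^sup>2 + x\<^sup>2 + y\<^sup>2 + z\<^sup>2 + w\<^sup>2 = n" for h x y z w
    using that abs_le_power2[of h] zero_le_power2[of x] zero_le_power2[of y]
      zero_le_power2[of z] zero_le_power2[of w]
    unfolding atLeastAtMost_iff by linarith
  have A: "?A = Sigma {-n..n} (\<lambda>h. {(x, y, z, w). x\<^sup>2 + y\<^sup>2 + z\<^sup>2 + w\<^sup>2 = n - h\<^sup>2})"
    using b by (auto simp: algebra_simps)
  have "(\<Sum>h \<in> {-n..n}. (n - 5 * h\<^sup>2) * r4 (n - h\<^sup>2)) = (\<Sum>(h, t) \<in> ?A. n - 5 * h\<^sup>2)"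
    unfolding r4_def by (rule sum_fibre_card[OF _ _ A]) simp_all
  also have "\<dots> = (\<Sum>(h, x, y, z, w) \<in> ?A. h\<^sup>2 + x\<^sup>2 + y\<^sup>2 + z\<^sup>2 + w\<^sup>2 - 5 * h\<^sup>2)"
    by (rule sum.cong) auto
  also have "\<dots> = (\<Sum>(h, x, y, z, w) \<in> ?A. x\<^sup>2) + (\<Sum>(h, x, y, z, w) \<in> ?A. y\<^sup>2)
      + (\<Sum>(h, x, y, z, w) \<in> ?A. z\<^sup>2) + (\<Sum>(h, x, y, z, w) \<in> ?A. w\<^sup>2)
      - 4 * (\<Sum>(h, x, y, z, w) \<in> ?A. h\<^sup>2)"
    unfolding sum_distrib_left sum_subtractf[symmetric] sum.distrib[symmetric]
    by (rule sum.cong) auto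
  also have "(\<Sum>(h, x, y, z, w) \<in> ?A. x\<^sup>2) = (\<Sum>(h, x, y, z, w) \<in> ?A. h\<^sup>2)"
    by (rule sum.reindex_bij_witness[where i = "\<lambda>(h, x, y, z, w). (x, h, y, z, w)"
          and j = "\<lambda>(h, x, y, z, w). (x, h, y, z, w)"]) auto
  also have "(\<Sum>(h, x, y, z, w) \<in> ?A. y\<^sup>2) = (\<Sum>(h, x, y, z, w) \<in> ?A. h\<^sup>2)"
    by (rule sum.reindex_bij_witness[where i = "\<lambda>(h, x, y, z, w). (y, x, h, z, w)"
          and j = "\<lambda>(h, x, y, z, w). (y, x, h, z, w)"]) auto
  also have "(\<Sum>(h, x, y, z, w) \<in> ?A. z\<^sup>2) = (\<Sum>(h, x, y, z, w) \<in> ?A. h\<^sup>2)"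
    by (rule sum.reindex_bij_witness[where i = "\<lambda>(h, x, y, z, w). (z, x, y, h, w)"
          and j = "\<lambda>(h, x, y, z, w). (z, x, y, h, w)"]) auto
  also have "(\<Sum>(h, x, y, z, w) \<in> ?A. w\<^sup>2) = (\<Sum>(h, x, y, z, w) \<in> ?A. h\<^sup>2)"
    by (rule sum.reindex_bij_witness[where i = "\<lambda>(h, x, y, z, w). (w, x, y, z, h)"
          and j = "\<lambda>(h, x, y, z, w). (w, x, y, z, h)"]) auto
  finally show ?thesis by (simp add: case_prod_unfold)
qed

text \<open>The term at h = 0 is n * f n and all others involve \<open>f\<close> only at n - h^2 <
  n, so each value at a positive argument is forced by the earlier ones.\<close>

lemma recurrence_unique:
  fixes f g :: "int \<Rightarrow> int"
  assumes f: "\<And>n. 0 < n \<Longrightarrow> (\<Sum>h \<in> {-n..n}. (n - c * h\<^sup>2) * f (n - h\<^sup>2)) = 0"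
    and g: "\<And>n. 0 < n \<Longrightarrow> (\<Sum>h \<in> {-n..n}. (n - c * h\<^sup>2) * g (n - h\<^sup>2)) = 0"
    and z: "f 0 = g 0" and neg: "\<And>n. n < 0 \<Longrightarrow> f n = g n"
  shows "f n = g n"
proof (induction "nat n" arbitrary: n rule: less_induct)
  case less
  show ?case
  proof (cases "0 < n")
    case True
    have "f (n - h\<^sup>2) = g (n - h\<^sup>2)" if "h \<noteq> 0" for h
    proof (rule less)
      have "0 < h\<^sup>2" using that by simp
      then show "nat (n - h\<^sup>2) < nat n" using True by linarith
    qed
    then have "(\<Sum>h \<in> {-n..n} - {0}. (n - c * h\<^sup>2) * f (n - h\<^sup>2)) = (\<Sum>h \<in> {-n..n} - {0}. (n - c * h\<^sup>2) * g (n - h\<^sup>2))"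
      by (intro sum.cong) auto
    moreover have rm: "(\<Sum>h \<in> {-n..n}. (n - c * h\<^sup>2) * k (n - h\<^sup>2))
        = n * k n + (\<Sum>h \<in> {-n..n} - {0}. (n - c * h\<^sup>2) * k (n - h\<^sup>2))" for k :: "int \<Rightarrow> int"
      using True by (subst sum.remove[of _ 0]) auto
    ultimately have "n * f n = n * g n"
      using f[OF True] g[OF True] rm[of f] rm[of g] by linarith
    then show ?thesis using True by simp
  next
    case False
    then show ?thesis using z neg[of n] by (cases "n = 0") auto
  qed
qed

section \<open>Liouville sums at 4n\<close>

lemma even_of_liouville_set_4:
  assumes "(X, d, e) \<in> liouville_set (4 * n)"
  shows "even X"
proof -
  have "X\<^sup>2 = 2 * (2 * n - 2 * d * e)" using assms by (simp add: liouville_set_def)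
  then have "even (X\<^sup>2)" by (metis dvd_triv_left)
  then show ?thesis by simp
qed

text \<open>Since \<open>X\<close> is even, X = 2 * h leaves d * e = n - h^2. This gives the sums
  the shape of the recurrences for \<open>r2\<close> and \<open>r4\<close>.\<close>

lemma sum_liouville_4:
  "(\<Sum>(X, d, e) \<in> liouville_set (4 * n). G X d e)
    = (\<Sum>h \<in> {-n..n}. \<Sum>(d, e) \<in> divisor_pairs (n - h\<^sup>2). G (2 * h) d e)"
proof -
  let ?A = "Sigma {-n..n} (\<lambda>h. divisor_pairs (n - h\<^sup>2))"
  have "(\<Sum>(X, d, e) \<in> liouville_set (4 * n). G X d e) = (\<Sum>(h, d, e) \<in> ?A. G (2 * h) d e)"
  proof (rule sum.reindex_bij_witness[where i = "\<lambda>(h, d, e). (2 * h, d, e)" and j = "\<lambda>(X, d, e). (X div 2, d, e)"],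
      goal_cases)
    case (1 t)
    then show ?case using even_of_liouville_set_4 by (cases t) auto
  next
    case (2 t)
    obtain X d e where t: "t = (X, d, e)" by (cases t)
    with 2 obtain h where h: "X = 2 * h" using even_of_liouville_set_4[of X d e n] by (auto elim: evenE)
    have "0 < d" "0 < e" "h\<^sup>2 + d * e = n" using 2 t h by (auto simp: liouville_set_def)
    moreover have "0 < d * e" using \<open>0 < d\<close> \<open>0 < e\<close> by simp
    ultimately have "- n \<le> h" "h \<le> n" "d * e = n - h\<^sup>2" using abs_le_power2[of h] by linarith+
    then show ?case using t h \<open>0 < d\<close> \<open>0 < e\<close> by (simp add: divisor_pairs_def)
  next
    case (5 t)
    then show ?case using even_of_liouville_set_4 by (cases t) auto
  qed (auto simp: divisor_pairs_def liouville_set_def power2_eq_square)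
  also have "\<dots> = (\<Sum>h \<in> {-n..n}. \<Sum>(d, e) \<in> divisor_pairs (n - h\<^sup>2). G (2 * h) d e)"
    by (rule sum.Sigma[symmetric]) (auto simp: finite_divisor_pairs)
  finally show ?thesis .
qed

lemma sum_liouville_neg:
  "(\<Sum>(X, d, e) \<in> liouville_set N. G X d e) = (\<Sum>(X, d, e) \<in> liouville_set N. G (- X) d e)"
  by (rule sum.reindex_bij_witness[where i = "\<lambda>(X, d, e). (- X, d, e)" and j = "\<lambda>(X, d, e). (- X, d, e)"])
    (auto simp: liouville_set_def)

lemma sum_liouville_swap:
  "(\<Sum>(X, d, e) \<in> liouville_set N. G X d e) = (\<Sum>(X, d, e) \<in> liouville_set N. G X e d)"
  by (rule sum.reindex_bij_witness[where i = "\<lambda>(X, d, e). (X, e, d)" and j = "\<lambda>(X, d, e). (X, e, d)"])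
    (auto simp: liouville_set_def algebra_simps)

lemma sum_liouville_odd:
  fixes G :: "int \<Rightarrow> int \<Rightarrow> int \<Rightarrow> int"
  assumes "\<And>X d e. G (- X) d e = - G X d e"
  shows "(\<Sum>(X, d, e) \<in> liouville_set N. G X d e) = 0"
  using sum_liouville_neg[of G N] by (simp add: assms case_prod_unfold sum_negf)

lemma sum_squares_equal:
  fixes t :: int
  assumes "0 < t"
  shows "(\<Sum>h \<in> {h \<in> {-(t\<^sup>2)..t\<^sup>2}. h\<^sup>2 = t\<^sup>2}. G h) = G t + G (- t)"
proof -
  have "{h \<in> {-(t\<^sup>2)..t\<^sup>2}. h\<^sup>2 = t\<^sup>2} = {t, - t}"
    using abs_le_power2[of t] assms by (auto simp: power2_eq_iff)
  then show ?thesis using assms by simp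
qed

text \<open>This sum and the two after it evaluate the corrections of
  \<open>liouville_square\<close> at s = 2 * t.\<close>

lemma sum_chi_weighted: "0 \<le> t \<Longrightarrow> (\<Sum>j \<in> {0<..<2 * t}. j * chi j) = - t * sg t"
proof (induction t rule: int_ge_induct)
  case base then show ?case by simp
next
  case (step t)
  have "{0<..<2 * (t + 1)} = {0<..<2 * t} \<union> {2 * t, 2 * t + 1} - {0}" using step by auto
  moreover have "(\<Sum>j \<in> {0<..<2 * t} \<union> {2 * t, 2 * t + 1} - {0}. j * chi j)
      = (\<Sum>j \<in> {0<..<2 * t} \<union> {2 * t, 2 * t + 1}. j * chi j)"
    by (rule sum.mono_neutral_left) auto
  moreover have "(\<Sum>j \<in> {0<..<2 * t} \<union> {2 * t, 2 * t + 1}. j * chi j)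
      = (\<Sum>j \<in> {0<..<2 * t}. j * chi j) + (2 * t + 1) * sg t"
    using chi_even[of "2 * t"] chi_add_double[of 1 t]
    by (subst sum.union_disjoint) (auto simp: chi_def add.commute)
  ultimately show ?case using step by (simp add: algebra_simps sg_add) (simp add: sg_def)
qed

lemma sum_sg: "0 < t \<Longrightarrow> (\<Sum>j \<in> {0<..<2 * t}. sg j) = -1"
proof (induction t rule: int_gr_induct)
  case base
  have "{0<..<2 :: int} = {1}" by auto
  then show ?case by (simp add: sg_def)
next
  case (step t)
  have "{0<..<2 * (t + 1)} = {0<..<2 * t} \<union> {2 * t, 2 * t + 1}" using step by auto
  moreover have "(\<Sum>j \<in> {0<..<2 * t} \<union> {2 * t, 2 * t + 1}. sg j) = (\<Sum>j \<in> {0<..<2 * t}. sg j)"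
    by (subst sum.union_disjoint) (auto simp: sg_def)
  ultimately show ?case using step by simp
qed

lemma sum_sg_cubes: "0 < t \<Longrightarrow> (\<Sum>j \<in> {0<..<2 * t}. sg j * j ^ 3) = 3 * t\<^sup>2 - 4 * t ^ 3"
proof (induction t rule: int_gr_induct)
  case base
  have "{0<..<2 :: int} = {1}" by auto
  then show ?case by (simp add: sg_def)
next
  case (step t)
  have "{0<..<2 * (t + 1)} = {0<..<2 * t} \<union> {2 * t, 2 * t + 1}" using step by auto
  moreover have "(\<Sum>j \<in> {0<..<2 * t} \<union> {2 * t, 2 * t + 1}. sg j * j ^ 3)
      = (\<Sum>j \<in> {0<..<2 * t}. sg j * j ^ 3) + ((2 * t) ^ 3 - (2 * t + 1) ^ 3)"
    by (subst sum.union_disjoint) (auto simp: sg_def)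
  ultimately show ?case using step by (simp add: algebra_simps power2_eq_square power3_eq_cube)
qed

lemma not_square_4: "(\<And>t. n \<noteq> t\<^sup>2) \<Longrightarrow> 4 * n \<noteq> s\<^sup>2" for n s :: int
proof
  assume n: "\<And>t. n \<noteq> t\<^sup>2" and s: "4 * n = s\<^sup>2"
  have "even (s\<^sup>2)" unfolding s[symmetric] by simp
  then obtain t where "s = 2 * t" by auto
  then show False using n s by simp
qed

section \<open>Jacobi's two-square theorem\<close>

definition quarter_r2 :: "int \<Rightarrow> int" where
  "quarter_r2 n = (\<Sum>(d, e) \<in> divisor_pairs n. chi d)"

text \<open>With h = X div 2 and d * e = n - h^2 the weight is n - 3 * h^2, so this is the
  recurrence of \<open>r2_recurrence\<close> for the divisor sum, with a defect when
  \<open>n\<close> is a square.\<close>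

lemma liouville_chi_sum:
  "(\<Sum>(X, d, e) \<in> liouville_set (4 * n). chi e * (d * e - 2 * (X div 2)\<^sup>2))
    = (if \<exists>t. n = t\<^sup>2 then n else 0)"
proof -
  \<comment> \<open>In the left summand the sign from \<open>chi\<close> and the factor
    \<open>sg\<close> cancel, leaving - chi e * (e - X) * (d + h) with X = 2 * h. All arguments
    \<open>w\<close> that occur are even; the value 0 at odd \<open>w\<close> keeps both symmetry
    laws valid everywhere.\<close>
  define F where "F x w z = (if even w then x * (w div 2) * chi z * sg (w div 2) else 0)" for x w z
  have F1: "F (- x) w z = - F x w z" for x w z by (simp add: F_def)
  have F2: "F x (- w) (- z) = F x w z" for x w z by (simp add: F_def dvd_neg_div)
  let ?S = "\<Sum>(X, d, e) \<in> liouville_set (4 * n). chi e * (d * e - 2 * (X div 2)\<^sup>2)"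
  have "(\<Sum>(X, d, e) \<in> liouville_set (4 * n). F (e - X) (2 * d + X) (2 * d + X - e))
      = (\<Sum>(X, d, e) \<in> liouville_set (4 * n).
          - (chi e * (d * e - 2 * (X div 2)\<^sup>2)) - (if even X then chi e * ((X div 2) * e - X * d) else 0))"
  proof (rule sum.cong[OF refl])
    fix t assume t: "t \<in> liouville_set (4 * n)"
    obtain X d e where tt: "t = (X, d, e)" by (cases t)
    obtain h where h: "X = 2 * h" using even_of_liouville_set_4[of X d e n] t tt by (auto elim: evenE)
    have "chi (2 * d + X - e) = - sg (d + h) * chi e"
      using chi_add_double[of "- e" "d + h"] by (simp add: h algebra_simps)
    then show "(case t of (X, d, e) \<Rightarrow> F (e - X) (2 * d + X) (2 * d + X - e)) = (case t of (X, d, e) \<Rightarrow>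
       - (chi e * (d * e - 2 * (X div 2)\<^sup>2)) - (if even X then chi e * ((X div 2) * e - X * d) else 0))"
      by (auto simp: tt F_def h sg_def algebra_simps power2_eq_square)
  qed
  also have "\<dots> = - ?S - (\<Sum>(X, d, e) \<in> liouville_set (4 * n). if even X then chi e * ((X div 2) * e - X * d) else 0)"
    unfolding sum_negf[symmetric] sum_subtractf[symmetric] by (rule sum.cong) auto
  also have "(\<Sum>(X, d, e) \<in> liouville_set (4 * n). if even X then chi e * ((X div 2) * e - X * d) else 0) = 0"
    by (rule sum_liouville_odd) (simp add: dvd_neg_div algebra_simps)
  finally have lhs: "(\<Sum>(X, d, e) \<in> liouville_set (4 * n). F (e - X) (2 * d + X) (2 * d + X - e)) = - ?S"
    by simp
  have rhs: "(\<Sum>(X, d, e) \<in> liouville_set (4 * n). F (d + e) X (d - e)) = 0"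
    by (rule sum_liouville_odd[of "\<lambda>X d e. F (d + e) X (d - e)"]) (simp add: F_def dvd_neg_div)
  show ?thesis
  proof (cases "\<exists>t. n = t\<^sup>2")
    case False
    then have "2 * - ?S = 0"
      using liouville_nonsquare[of F "4 * n"] F1 F2 not_square_4[of n] lhs rhs by simp
    then show ?thesis using False by simp
  next
    case True
    then obtain t' where "n = t'\<^sup>2" by blast
    then obtain t where t: "n = t\<^sup>2" "0 \<le> t" by (metis abs_ge_zero power2_abs)
    show ?thesis
    proof (cases "t = 0")
      case True
      then have "liouville_set (4 * n) = {}" 
        by (auto simp: liouville_set_def t) (smt (verit) zero_le_power2 mult_pos_pos)
      then show ?thesis using True t by simp
    next
      case False
      then have p: "0 < 2 * t" using t by simp
      have 4: "4 * n = (2 * t)\<^sup>2" using t by simp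
      have "(\<Sum>j \<in> {0<..<2 * t}. F j (2 * t) j) = (\<Sum>j \<in> {0<..<2 * t}. t * sg t * (j * chi j))"
        by (rule sum.cong) (auto simp: F_def)
      also have "\<dots> = - (t\<^sup>2)"
        unfolding sum_distrib_left[symmetric] using sum_chi_weighted[of t] t
        by (simp add: power2_eq_square sg_def)
      finally have 1: "(\<Sum>j \<in> {0<..<2 * t}. F j (2 * t) j) = - (t\<^sup>2)" .
      have 2: "(\<Sum>j \<in> {0<..<2 * t}. F (2 * t) (2 * t - 2 * j) (2 * t - 2 * j)) = 0"
        by (rule sum.neutral) (auto simp: F_def chi_even)
      have "2 * - ?S = 2 * - (t\<^sup>2)"
        using liouville_square[of F "2 * t"] F1 F2 p lhs rhs 1 2 unfolding 4 by simp
      then show ?thesis using t by auto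
    qed
  qed
qed

theorem r2_formula:
  assumes "0 < n"
  shows "r2 n = 4 * quarter_r2 n"
proof -
  \<comment> \<open>The value 1 at 0 is \<open>r2 0\<close>, while \<open>quarter_r2 0\<close> is an
    empty sum. For n = t^2 the two terms with h^2 = n contribute - 2 * n each, which cancels 4 times
    the defect \<open>n\<close>.\<close>
  define f where "f k = (if k = 0 then 1 else 4 * quarter_r2 k)" for k
  have "r2 n = f n"
  proof (rule recurrence_unique[where c = 3 and f = r2 and g = f])
    show "(\<Sum>h \<in> {-n..n}. (n - 3 * h\<^sup>2) * r2 (n - h\<^sup>2)) = 0" for n by (rule r2_recurrence)
    show "r2 0 = f 0" by (simp add: f_def r2_0)
  next
    fix k :: int assume "k < 0"
    then show "r2 k = f k"
      by (simp add: f_def r2_neg quarter_r2_def divisor_pairs_nonpos)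
  next
    fix n :: int assume n: "0 < n"
    have "(\<Sum>h \<in> {-n..n}. (n - 3 * h\<^sup>2) * f (n - h\<^sup>2))
       = (\<Sum>h \<in> {-n..n}. 4 * ((n - 3 * h\<^sup>2) * quarter_r2 (n - h\<^sup>2)) + (if h\<^sup>2 = n then - 2 * n else 0))"
      by (rule sum.cong) (auto simp: f_def quarter_r2_def divisor_pairs_nonpos)
    also have "\<dots> = 4 * (\<Sum>h \<in> {-n..n}. (n - 3 * h\<^sup>2) * quarter_r2 (n - h\<^sup>2))
        + (\<Sum>h \<in> {h \<in> {-n..n}. h\<^sup>2 = n}. - 2 * n)"
      unfolding sum.inter_filter[OF finite_atLeastAtMost_int] sum_distrib_left sum.distrib by (rule refl)
    also have "(\<Sum>h \<in> {-n..n}. (n - 3 * h\<^sup>2) * quarter_r2 (n - h\<^sup>2))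
        = (\<Sum>h \<in> {-n..n}. \<Sum>(d, e) \<in> divisor_pairs (n - h\<^sup>2). chi d * (d * e - 2 * ((2 * h) div 2)\<^sup>2))"
    proof (rule sum.cong[OF refl])
      fix h
      show "(n - 3 * h\<^sup>2) * quarter_r2 (n - h\<^sup>2)
          = (\<Sum>(d, e) \<in> divisor_pairs (n - h\<^sup>2). chi d * (d * e - 2 * ((2 * h) div 2)\<^sup>2))"
        unfolding quarter_r2_def sum_distrib_left
        by (rule sum.cong) (auto simp: divisor_pairs_def)
    qed
    also have "\<dots> = (\<Sum>(X, d, e) \<in> liouville_set (4 * n). chi d * (d * e - 2 * (X div 2)\<^sup>2))"
      by (rule sum_liouville_4[symmetric])
    also have "\<dots> = (\<Sum>(X, d, e) \<in> liouville_set (4 * n). chi e * (e * d - 2 * (X div 2)\<^sup>2))"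
      by (rule sum_liouville_swap)
    also have "\<dots> = (if \<exists>t. n = t\<^sup>2 then n else 0)"
      unfolding liouville_chi_sum[symmetric] by (simp add: mult.commute)
    also have "4 * \<dots> + (\<Sum>h \<in> {h \<in> {-n..n}. h\<^sup>2 = n}. - 2 * n) = 0"
    proof (cases "\<exists>t. n = t\<^sup>2")
      case True
      then obtain t' where "n = t'\<^sup>2" by blast
      then obtain t where t: "n = t\<^sup>2" "0 < t" using n
        by (metis abs_ge_zero power2_abs less_le power_zero_numeral)
      show ?thesis using sum_squares_equal[OF t(2), of "\<lambda>_. - 2 * n"] True t(1) by simp
    next
      case False
      then have "{h \<in> {-n..n}. h\<^sup>2 = n} = {}" by auto
      then show ?thesis using False by (simp only: sum.empty) simp
    qed
    finally show "(\<Sum>h \<in> {-n..n}. (n - 3 * h\<^sup>2) * f (n - h\<^sup>2)) = 0" .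
  qed
  then show ?thesis using assms by (simp add: f_def)
qed

section \<open>Jacobi's four-square theorem\<close>

definition signed_sigma :: "int \<Rightarrow> int" where
  "signed_sigma n = (\<Sum>(d, e) \<in> divisor_pairs n. sg (d + e) * e)"

text \<open>Comparing the cubes of e - X and d + e in Liouville's identity cancels e^3 and leaves
  multiples of e * (d * e - X^2). With X = 2 * h and d * e = n - h^2 the second factor is n - 5 *
  h^2, the weight of \<open>r4_recurrence\<close>.\<close>

lemma liouville_cube_sum:
  "(\<Sum>(X, d, e) \<in> liouville_set (4 * n). sg (d + e + X div 2) * (e * (d * e - X\<^sup>2)))
    = (if \<exists>t. n = t\<^sup>2 then - n * sg n else 0)"
proof -
  \<comment> \<open>The sign is chosen to equal \<open>sg (d + e + X div 2)\<close> in both the left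
    and the right summand.\<close>
  define F where "F x w z = (if even w then sg (x + w div 2) * x ^ 3 else 0)" for x w z :: int
  have F1: "F (- x) w z = - F x w z" for x w z by (simp add: F_def sg_add sg_diff)
  have F2: "F x (- w) (- z) = F x w z" for x w z by (simp add: F_def dvd_neg_div sg_add sg_diff)
  let ?s = "\<lambda>X d e. sg (d + e + X div 2)"
  let ?sum = "\<lambda>G. (\<Sum>(X, d, e) \<in> liouville_set (4 * n). ?s X d e * G X d e)"
  have "(\<Sum>(X, d, e) \<in> liouville_set (4 * n). F (e - X) (2 * d + X) (2 * d + X - e))
      = (\<Sum>(X, d, e) \<in> liouville_set (4 * n). (?s X d e * e ^ 3 + 3 * (?s X d e * (e * X\<^sup>2)))
          - (if even X then ?s X d e * (3 * e\<^sup>2 * X + X ^ 3) else 0))"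
  proof (rule sum.cong[OF refl])
    fix t assume t: "t \<in> liouville_set (4 * n)"
    obtain X d e where tt: "t = (X, d, e)" by (cases t)
    obtain h where h: "X = 2 * h" using even_of_liouville_set_4[of X d e n] t tt by (auto elim: evenE)
    have "sg (e - X + (2 * d + X) div 2) = sg (d + e + X div 2)"
      by (auto simp: h sg_def)
    then show "(case t of (X, d, e) \<Rightarrow> F (e - X) (2 * d + X) (2 * d + X - e)) = (case t of (X, d, e) \<Rightarrow>
       (?s X d e * e ^ 3 + 3 * (?s X d e * (e * X\<^sup>2))) - (if even X then ?s X d e * (3 * e\<^sup>2 * X + X ^ 3) else 0))"
      by (simp add: tt F_def h algebra_simps power2_eq_square power3_eq_cube)
  qed
  also have "\<dots> = ?sum (\<lambda>X d e. e ^ 3) + 3 * ?sum (\<lambda>X d e. e * X\<^sup>2)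
     - (\<Sum>(X, d, e) \<in> liouville_set (4 * n). if even X then ?s X d e * (3 * e\<^sup>2 * X + X ^ 3) else 0)"
    unfolding sum_distrib_left sum_subtractf[symmetric] sum.distrib[symmetric]
    by (rule sum.cong) auto
  also have "(\<Sum>(X, d, e) \<in> liouville_set (4 * n). if even X then ?s X d e * (3 * e\<^sup>2 * X + X ^ 3) else 0) = 0"
    by (rule sum_liouville_odd[of "\<lambda>X d e. if even X then ?s X d e * (3 * e\<^sup>2 * X + X ^ 3) else 0"])
      (simp add: dvd_neg_div sg_add sg_diff algebra_simps)
  finally have lhs: "(\<Sum>(X, d, e) \<in> liouville_set (4 * n). F (e - X) (2 * d + X) (2 * d + X - e))
      = ?sum (\<lambda>X d e. e ^ 3) + 3 * ?sum (\<lambda>X d e. e * X\<^sup>2)" by simp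
  have "(\<Sum>(X, d, e) \<in> liouville_set (4 * n). F (d + e) X (d - e))
      = (\<Sum>(X, d, e) \<in> liouville_set (4 * n). ?s X d e * d ^ 3 + ?s X d e * e ^ 3
          + 3 * (?s X d e * (d * d * e)) + 3 * (?s X d e * (e * d * e)))"
  proof (rule sum.cong[OF refl])
    fix t assume t: "t \<in> liouville_set (4 * n)"
    obtain X d e where tt: "t = (X, d, e)" by (cases t)
    have "even X" using even_of_liouville_set_4[of X d e n] t tt by auto
    then show "(case t of (X, d, e) \<Rightarrow> F (d + e) X (d - e)) = (case t of (X, d, e) \<Rightarrow>
       ?s X d e * d ^ 3 + ?s X d e * e ^ 3 + 3 * (?s X d e * (d * d * e)) + 3 * (?s X d e * (e * d * e)))"
      by (simp add: tt F_def algebra_simps power2_eq_square power3_eq_cube)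
  qed
  also have "\<dots> = ?sum (\<lambda>X d e. d ^ 3) + ?sum (\<lambda>X d e. e ^ 3)
      + 3 * ?sum (\<lambda>X d e. d * d * e) + 3 * ?sum (\<lambda>X d e. e * d * e)"
    unfolding sum_distrib_left sum.distrib[symmetric] by (rule sum.cong) auto
  also have "?sum (\<lambda>X d e. d ^ 3) = ?sum (\<lambda>X d e. e ^ 3)"
    by (subst sum_liouville_swap) (simp add: add.commute)
  also have "?sum (\<lambda>X d e. d * d * e) = ?sum (\<lambda>X d e. e * d * e)"
    by (subst sum_liouville_swap) (simp add: ac_simps)
  finally have rhs: "(\<Sum>(X, d, e) \<in> liouville_set (4 * n). F (d + e) X (d - e))
      = 2 * ?sum (\<lambda>X d e. e ^ 3) + 6 * ?sum (\<lambda>X d e. e * d * e)" by simp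
  have goal: "?sum (\<lambda>X d e. e * (d * e - X\<^sup>2)) = ?sum (\<lambda>X d e. e * d * e) - ?sum (\<lambda>X d e. e * X\<^sup>2)"
    unfolding sum_subtractf[symmetric] by (rule sum.cong) (auto simp: algebra_simps)
  show ?thesis
  proof (cases "\<exists>t. n = t\<^sup>2")
    case False
    have "2 * (?sum (\<lambda>X d e. e ^ 3) + 3 * ?sum (\<lambda>X d e. e * X\<^sup>2))
        = 2 * ?sum (\<lambda>X d e. e ^ 3) + 6 * ?sum (\<lambda>X d e. e * d * e)"
      using liouville_nonsquare[of F "4 * n"] F1 F2 not_square_4[of n] False lhs rhs by simp
    then show ?thesis using False goal by simp
  next
    case True
    then obtain t' where "n = t'\<^sup>2" by blast
    then obtain t where t: "n = t\<^sup>2" "0 \<le> t" by (metis abs_ge_zero power2_abs)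
    show ?thesis
    proof (cases "t = 0")
      case True
      then have "liouville_set (4 * n) = {}"
        by (auto simp: liouville_set_def t) (smt (verit) zero_le_power2 mult_pos_pos)
      then show ?thesis using True t by simp
    next
      case False
      then have p: "0 < t" "0 < 2 * t" using t by simp_all
      have 4: "4 * n = (2 * t)\<^sup>2" using t by simp
      have "(\<Sum>j \<in> {0<..<2 * t}. F j (2 * t) j) = (\<Sum>j \<in> {0<..<2 * t}. sg t * (sg j * j ^ 3))"
        by (rule sum.cong) (auto simp: F_def sg_add sg_diff)
      then have 1: "(\<Sum>j \<in> {0<..<2 * t}. F j (2 * t) j) = sg t * (3 * t\<^sup>2 - 4 * t ^ 3)"
        unfolding sum_distrib_left[symmetric] using sum_sg_cubes[of t] p by simp
      have "(\<Sum>j \<in> {0<..<2 * t}. F (2 * t) (2 * t - 2 * j) (2 * t - 2 * j))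
          = (\<Sum>j \<in> {0<..<2 * t}. (8 * sg t * t ^ 3) * sg j)"
        by (rule sum.cong) (auto simp: F_def sg_def)
      then have 2: "(\<Sum>j \<in> {0<..<2 * t}. F (2 * t) (2 * t - 2 * j) (2 * t - 2 * j)) = - (8 * sg t * t ^ 3)"
        unfolding sum_distrib_left[symmetric] using sum_sg[of t] p by simp
      \<comment> \<open>The t^3 parts of the two corrections cancel, leaving 6 * sg t * t^2.\<close>
      have "2 * (?sum (\<lambda>X d e. e ^ 3) + 3 * ?sum (\<lambda>X d e. e * X\<^sup>2))
        = 2 * ?sum (\<lambda>X d e. e ^ 3) + 6 * ?sum (\<lambda>X d e. e * d * e) + 6 * (sg t * t\<^sup>2)"
        using liouville_square[of F "2 * t"] F1 F2 p lhs rhs 1 2 unfolding 4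
        by (simp add: algebra_simps)
      then have "?sum (\<lambda>X d e. e * (d * e - X\<^sup>2)) = - (sg t * t\<^sup>2)" using goal by simp
      then show ?thesis using t True by (simp add: algebra_simps)
    qed
  qed
qed

theorem r4_formula:
  assumes "0 < n"
  shows "r4 n = - 8 * sg n * signed_sigma n"
proof -
  \<comment> \<open>Again the value at 0 is set apart: for a square \<open>n\<close> the two terms
    with h^2 = n contribute - 4 * n each and cancel - 8 * sg n times the defect - n * sg n.\<close>
  define f where "f k = (if k = 0 then 1 else - 8 * sg k * signed_sigma k)" for k
  have "r4 n = f n"
  proof (rule recurrence_unique[where c = 5 and f = r4 and g = f])
    show "(\<Sum>h \<in> {-n..n}. (n - 5 * h\<^sup>2) * r4 (n - h\<^sup>2)) = 0" for n by (rule r4_recurrence)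
    show "r4 0 = f 0" by (simp add: f_def r4_0)
  next
    fix k :: int assume "k < 0"
    then show "r4 k = f k"
      by (simp add: f_def r4_neg signed_sigma_def divisor_pairs_nonpos)
  next
    fix n :: int assume n: "0 < n"
    have "(\<Sum>h \<in> {-n..n}. (n - 5 * h\<^sup>2) * f (n - h\<^sup>2))
       = (\<Sum>h \<in> {-n..n}. - 8 * sg n * ((n - 5 * h\<^sup>2) * sg h * signed_sigma (n - h\<^sup>2))
            + (if h\<^sup>2 = n then - 4 * n else 0))"
    proof (rule sum.cong[OF refl])
      fix h
      have "sg (n - h\<^sup>2) = sg n * sg h" by (simp add: sg_def)
      then show "(n - 5 * h\<^sup>2) * f (n - h\<^sup>2) = - 8 * sg n * ((n - 5 * h\<^sup>2) * sg h * signed_sigma (n - h\<^sup>2))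
            + (if h\<^sup>2 = n then - 4 * n else 0)"
        by (auto simp: f_def signed_sigma_def divisor_pairs_nonpos)
    qed
    also have "\<dots> = - 8 * sg n * (\<Sum>h \<in> {-n..n}. (n - 5 * h\<^sup>2) * sg h * signed_sigma (n - h\<^sup>2))
        + (\<Sum>h \<in> {h \<in> {-n..n}. h\<^sup>2 = n}. - 4 * n)"
      unfolding sum.inter_filter[OF finite_atLeastAtMost_int] sum_distrib_left sum.distrib by (rule refl)
    also have "(\<Sum>h \<in> {-n..n}. (n - 5 * h\<^sup>2) * sg h * signed_sigma (n - h\<^sup>2))
        = (\<Sum>h \<in> {-n..n}. \<Sum>(d, e) \<in> divisor_pairs (n - h\<^sup>2).
            sg (d + e + (2 * h) div 2) * (e * (d * e - (2 * h)\<^sup>2)))"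
    proof (rule sum.cong[OF refl])
      fix h
      show "(n - 5 * h\<^sup>2) * sg h * signed_sigma (n - h\<^sup>2)
          = (\<Sum>(d, e) \<in> divisor_pairs (n - h\<^sup>2). sg (d + e + (2 * h) div 2) * (e * (d * e - (2 * h)\<^sup>2)))"
        unfolding signed_sigma_def sum_distrib_left
        by (rule sum.cong) (auto simp: divisor_pairs_def sg_add[of _ h])
    qed
    also have "\<dots> = (\<Sum>(X, d, e) \<in> liouville_set (4 * n). sg (d + e + X div 2) * (e * (d * e - X\<^sup>2)))"
      by (rule sum_liouville_4[symmetric])
    also have "\<dots> = (if \<exists>t. n = t\<^sup>2 then - n * sg n else 0)"
      by (rule liouville_cube_sum)
    also have "- 8 * sg n * \<dots> + (\<Sum>h \<in> {h \<in> {-n..n}. h\<^sup>2 = n}. - 4 * n) = 0"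
    proof (cases "\<exists>t. n = t\<^sup>2")
      case True
      then obtain t' where "n = t'\<^sup>2" by blast
      then obtain t where t: "n = t\<^sup>2" "0 < t" using n
        by (metis abs_ge_zero power2_abs less_le power_zero_numeral)
      have "- 8 * sg n * (- n * sg n) = 8 * n" by (simp add: sg_def)
      then show ?thesis using sum_squares_equal[OF t(2), of "\<lambda>_. - 4 * n"] True
        unfolding t(1)[symmetric] by simp
    next
      case False
      then have "{h \<in> {-n..n}. h\<^sup>2 = n} = {}" by auto
      then show ?thesis using False by (simp only: sum.empty) simp
    qed
    finally show "(\<Sum>h \<in> {-n..n}. (n - 5 * h\<^sup>2) * f (n - h\<^sup>2)) = 0" .
  qed
  then show ?thesis using assms by (simp add: f_def)
qed

section \<open>Counting reduced forms\<close>

text \<open>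
  A tile \<open>(a, b, X, Y)\<close> is the integer matrix \<open>A\<close> with columns \<open>(a, Y)\<close>, \<open>(X, b)\<close>. Up to sign, the tiles with
  a given column lattice correspond to the ideal quadrilaterals in the orbit of the one with
  vertices \<open>e\<^sub>1\<close>, \<open>e\<^sub>1 + e\<^sub>2\<close>, \<open>e\<^sub>2\<close>, \<open>e\<^sub>1 - e\<^sub>2\<close> under the group generated by reflections in its edges; the sign of the
  determinant tells whether the number of reflections is even. \<open>side\<close> orients the edge \<open>e\<^sub>1\<close>, \<open>e\<^sub>1 + e\<^sub>2\<close> (the
  other three edges follow by symmetry): it changes sign under reflection in that edge, and
  exactly one edge of a tile is negative, unless the tile is reduced and all edges are positive.
  Scaling the second row by \<open>q\<close> changes the orientation of finitely many edges only, hence does not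
  change the number of reduced tiles; for large \<open>q\<close> these are the Hermite normal forms.
\<close>

definition side :: "int \<Rightarrow> int \<Rightarrow> int \<Rightarrow> int \<Rightarrow> int" where
  "side a b X Y = sgn (sgn a * (a + X) + sgn (a + b + X + Y) * (a + Y))"

text \<open>The residue of X + Y modulo 4 encodes the sign of the determinant: reflection in an edge
  changes both at once, so the set is closed under reflections.\<close>

definition tiles :: "int \<Rightarrow> (int \<times> int \<times> int \<times> int) set" where
  "tiles m = {(a, b, X, Y). odd a \<and> odd b \<and> even X \<and> even Y \<and>
     (a * b - X * Y = m \<and> 4 dvd X + Y \<or> a * b - X * Y = - m \<and> \<not> 4 dvd X + Y)}"

text \<open>In terms of w = (X + Y) / 2 this says \<bar>w\<bar> < a and \<bar>w\<bar> < b, the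
  inequalities of \<open>reduced_forms\<close>. It forces a positive determinant, since X * Y \<le>
  w^2.\<close>

definition reduced :: "int \<Rightarrow> int \<Rightarrow> int \<Rightarrow> int \<Rightarrow> bool" where
  "reduced a b X Y \<longleftrightarrow> \<bar>X + Y\<bar> < 2 * a \<and> \<bar>X + Y\<bar> < 2 * b"

section \<open>Symmetries of tiles\<close>

lemma tiles_neg: "(a, b, X, Y) \<in> tiles m \<Longrightarrow> (- a, - b, - X, - Y) \<in> tiles m"
proof -
  have "4 dvd - X - Y \<longleftrightarrow> 4 dvd X + Y" "4 dvd - Y - X \<longleftrightarrow> 4 dvd X + Y" by presburger+
  then show "(a, b, X, Y) \<in> tiles m \<Longrightarrow> (- a, - b, - X, - Y) \<in> tiles m" by (auto simp: tiles_def)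
qed

lemma tiles_conj: "(a, b, X, Y) \<in> tiles m \<Longrightarrow> (a, b, - X, - Y) \<in> tiles m"
proof -
  have "4 dvd - X - Y \<longleftrightarrow> 4 dvd X + Y" "4 dvd - Y - X \<longleftrightarrow> 4 dvd X + Y" by presburger+
  then show "(a, b, X, Y) \<in> tiles m \<Longrightarrow> (a, b, - X, - Y) \<in> tiles m" by (auto simp: tiles_def)
qed

lemma tiles_swap: "(a, b, X, Y) \<in> tiles m \<Longrightarrow> (b, a, Y, X) \<in> tiles m"
  by (auto simp: tiles_def algebra_simps)

text \<open>Right multiplication by the reflection that fixes e1 and sends e1 + e2 to its negative,
  so that e2 goes to - 2 e1 - e2. It preserves the column lattice.\<close>

lemma tiles_reflect: "(a, b, X, Y) \<in> tiles m \<Longrightarrow> (a, - 2 * Y - b, - 2 * a - X, Y) \<in> tiles m"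
proof -
  assume t: "(a, b, X, Y) \<in> tiles m"
  then have "odd a" "even X" "even Y" by (auto simp: tiles_def)
  then have "4 dvd (- 2 * a - X) + Y \<longleftrightarrow> \<not> 4 dvd X + Y" by presburger
  moreover have "a * (- 2 * Y - b) - (- 2 * a - X) * Y = - (a * b - X * Y)" by (simp add: algebra_simps)
  ultimately show ?thesis using t by (auto simp: tiles_def)
qed

text \<open>Scaling the rows by \<open>p\<close> and \<open>q\<close>, both 1 modulo 4, does not
  change X + Y modulo 4.\<close>

lemma tiles_scale:
  assumes "(a, b, X, Y) \<in> tiles m" "p mod 4 = 1" "q mod 4 = 1"
  shows "(p * a, q * b, p * X, q * Y) \<in> tiles (p * q * m)"
proof -
  obtain k l where k: "p = 4 * k + 1" "q = 4 * l + 1" using assms(2,3) by (metis mult_div_mod_eq)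
  have "p * X + q * Y = X + Y + 4 * (k * X + l * Y)" unfolding k by (simp add: algebra_simps)
  then have "4 dvd p * X + q * Y \<longleftrightarrow> 4 dvd X + Y" by presburger
  moreover have "odd p" "odd q" using k by simp_all
  moreover have "p * a * (q * b) - p * X * (q * Y) = p * q * (a * b - X * Y)" by (simp add: algebra_simps)
  ultimately show ?thesis using assms(1) by (auto simp: tiles_def)
qed

text \<open>Its use is that a + b + X + Y is never 0, so the sign taken of it in \<open>side\<close>
  is 1 or -1. If 4 divides X + Y then a * b is 1 modulo 4 and a, b are congruent; otherwise a * b is
  3 and a + b is 0 modulo 4.\<close>

lemma tiles_sum_mod_4:
  assumes "(a, b, X, Y) \<in> tiles m" "m mod 4 = 1"
  shows "(a + b + X + Y) mod 4 = 2"
proof -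
  have t: "odd a" "odd b" "even X" "even Y" using assms by (auto simp: tiles_def)
  obtain x y where xy: "X = 2 * x" "Y = 2 * y" using t by (auto elim!: evenE)
  have X: "X * Y mod 4 = 0" by (simp add: xy)
  have a: "a mod 4 = 1 \<or> a mod 4 = 3" "b mod 4 = 1 \<or> b mod 4 = 3" using t by presburger+
  have ab: "a * b mod 4 = (a mod 4) * (b mod 4) mod 4" by (simp add: mod_mult_eq)
  consider "a * b - X * Y = m" "4 dvd X + Y" | "a * b - X * Y = - m" "\<not> 4 dvd X + Y"
    using assms by (auto simp: tiles_def)
  then show ?thesis
  proof cases
    case 1
    then have "a * b mod 4 = 1" using X assms(2) by presburger
    then have "a mod 4 = b mod 4" using a ab by auto
    then show ?thesis using 1(2) a by presburger
  next
    case 2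
    then have "a * b mod 4 = 3" using X assms(2) by presburger
    then have "(a + b) mod 4 = 0" using a ab by (auto simp: mod_add_eq[of a 4 b, symmetric])
    then show ?thesis using 2(2) t by presburger
  qed
qed

section \<open>Orientations of edges\<close>

lemma sgn_minus_int: "sgn (- x) = - sgn x" for x :: int
  by (simp add: sgn_if)

lemma side_neg: "side (- a) (- b) (- X) (- Y) = side a b X Y"
proof -
  have 1: "- a + - b + - X + - Y = - (a + b + X + Y)" by simp
  show ?thesis unfolding side_def 1 sgn_minus_int by (simp add: algebra_simps)
qed

lemma side_reflect: "side a (- 2 * Y - b) (- 2 * a - X) Y = - side a b X Y"
proof -
  have 1: "a + (- 2 * Y - b) + (- 2 * a - X) + Y = - (a + b + X + Y)" "a + (- 2 * a - X) = - (a + X)"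
    by simp_all
  have 2: "sgn a * - (a + X) + - sgn (a + b + X + Y) * (a + Y)
      = - (sgn a * (a + X) + sgn (a + b + X + Y) * (a + Y))" by (simp add: algebra_simps)
  show ?thesis unfolding side_def 1 sgn_minus_int 2 ..
qed

text \<open>The products a * (a + b + X + Y) and (a + X) * (a + Y) differ by \<open>m\<close> or -
  m. If they have equal signs, both summands in \<open>side\<close> have the sign of a * (a + X),
  which depends on the first row only and survives scaling by positive factors. Otherwise their
  absolute values add up to \<open>m\<close>, which bounds all entries.\<close>

lemma side_eq_or_bounded:
  assumes t: "(a, b, X, Y) \<in> tiles m" and m: "m mod 4 = 1" "0 < m"
  shows "side a b X Y = sgn a * sgn (a + X) \<or> (\<forall>z \<in> {a, b, X, Y}. \<bar>z\<bar> \<le> 4 * m)"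
proof -
  let ?c = "a + b + X + Y"
  have nz: "a \<noteq> 0" "a + X \<noteq> 0" "a + Y \<noteq> 0" using t by (auto simp: tiles_def; presburger)+
  have c: "?c \<noteq> 0" using tiles_sum_mod_4[OF t m(1)] by auto
  have det: "a * ?c - (a + X) * (a + Y) = m \<or> a * ?c - (a + X) * (a + Y) = - m"
    using t by (auto simp: tiles_def algebra_simps)
  show ?thesis
  proof (cases "sgn (a * ?c) = sgn ((a + X) * (a + Y))")
    case True
    then have "sgn a * sgn ?c = sgn (a + X) * sgn (a + Y)" by (simp add: sgn_mult)
    then have "side a b X Y = sgn a * sgn (a + X)"
      using nz c unfolding side_def by (auto simp: sgn_if split: if_splits)
    then show ?thesis by simp
  next
    case False
    have "a * ?c \<noteq> 0" "(a + X) * (a + Y) \<noteq> 0" using nz c by auto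
    then have "\<bar>a * ?c\<bar> + \<bar>(a + X) * (a + Y)\<bar> = m"
      using False det m(2) by (auto simp: sgn_if split: if_splits)
    moreover have "\<bar>x\<bar> \<le> \<bar>x * y\<bar>" "\<bar>y\<bar> \<le> \<bar>x * y\<bar>" if "x \<noteq> 0" "y \<noteq> 0" for x y :: int
      using that mult_left_mono[of 1 "\<bar>y\<bar>" "\<bar>x\<bar>"] mult_right_mono[of 1 "\<bar>x\<bar>" "\<bar>y\<bar>"] by (auto simp: abs_mult)
    ultimately have "\<bar>a\<bar> \<le> m" "\<bar>?c\<bar> \<le> m" "\<bar>a + X\<bar> \<le> m" "\<bar>a + Y\<bar> \<le> m" using nz c
      by (smt (verit))+
    \<comment> \<open>The factor 4 comes from b = ?c - (a + X) - (a + Y) + a.\<close>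
    then show ?thesis by auto
  qed
qed

text \<open>For b > 0 and \<bar>X + Y\<bar> < a + b the orientations are the signs of 2 * a + w, 2 *
  a - w, 2 * b + w, 2 * b - w with w = X + Y; at most one is negative, and none exactly when the
  tile is reduced. In all other cases two orientations are 1 and the other two are the signs of X -
  Y and Y - X, which cancel.\<close>

lemma sum_sides:
  assumes t: "(a, b, X, Y) \<in> tiles m" and m: "m mod 4 = 1" "0 < m" and a: "0 < a"
  shows "side a b X Y + side a b (- X) (- Y) + side b a Y X + side b a (- Y) (- X)
    = 2 + 2 * of_bool (reduced a b X Y)"
proof -
  have c1: "a + b + X + Y \<noteq> 0" using tiles_sum_mod_4[OF t m(1)] by auto
  have c2: "a + b - X - Y \<noteq> 0" using tiles_sum_mod_4[OF tiles_conj[OF t] m(1)] by auto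
  have p: "odd a" "odd b" "even X" "even Y" using t by (auto simp: tiles_def)
  have sq: "4 * (X * Y) \<le> (X + Y)\<^sup>2"
    using zero_le_power2[of "X - Y"] by (simp add: power2_eq_square algebra_simps)
  \<comment> \<open>No orientation vanishes in this range: \<bar>X + Y\<bar> = 2 * c with
    \<open>c\<close> odd is impossible modulo 4 if 4 divides X + Y, and otherwise by size, because
    the determinant is then negative.\<close>
  have n3: "2 * c + X + Y \<noteq> 0" "2 * c - X - Y \<noteq> 0"
    if "\<bar>X + Y\<bar> < a + b" "0 < b" "c = a \<or> c = b" for c
  proof -
    have "\<bar>X + Y\<bar> \<noteq> 2 * c"
    proof
      assume e: "\<bar>X + Y\<bar> = 2 * c"
      have "odd c" using that p by auto
      show False
      proof (cases "4 dvd X + Y")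
        case True
        then show False using e \<open>odd c\<close> by (auto simp: abs_if split: if_splits) presburger+
      next
        case False
        then have "a * b < X * Y" using t m by (auto simp: tiles_def)
        moreover have "(X + Y)\<^sup>2 = 4 * (c * c)" 
          using arg_cong[OF e, of "\<lambda>x. x\<^sup>2"] by (simp add: power2_eq_square)
        ultimately have "a * b < c * c" using sq by linarith
        moreover have "c * c \<le> a * b" using that e a
          by (auto intro!: mult_left_mono mult_right_mono)
        ultimately show False by simp
      qed
    qed
    moreover have "0 < c" using that a by auto
    ultimately show "2 * c + X + Y \<noteq> 0" "2 * c - X - Y \<noteq> 0" by - linarith+
  qed
  have s: "side a b X Y = sgn ((a + X) + sgn (a + b + X + Y) * (a + Y))"
    "side a b (- X) (- Y) = sgn ((a - X) + sgn (a + b - X - Y) * (a - Y))"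
    "side b a Y X = sgn (sgn b * (b + Y) + sgn (a + b + X + Y) * (b + X))"
    "side b a (- Y) (- X) = sgn (sgn b * (b - Y) + sgn (a + b - X - Y) * (b - X))"
  proof -
    have e: "b + a + Y + X = a + b + X + Y" "b + a + - Y + - X = a + b - X - Y" "a + b + - X + - Y = a + b - X - Y"
      by simp_all
    show "side a b X Y = sgn ((a + X) + sgn (a + b + X + Y) * (a + Y))"
      "side a b (- X) (- Y) = sgn ((a - X) + sgn (a + b - X - Y) * (a - Y))"
      "side b a Y X = sgn (sgn b * (b + Y) + sgn (a + b + X + Y) * (b + X))"
      "side b a (- Y) (- X) = sgn (sgn b * (b - Y) + sgn (a + b - X - Y) * (b - X))"
      using a unfolding side_def e by simp_all
  qed
  have anti: "sgn (Y - X) = - sgn (X - Y)" by (simp add: sgn_if)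
  have big: "sgn (a + b + X + Y) = 1 \<longleftrightarrow> - (a + b) < X + Y" "sgn (a + b + X + Y) = -1 \<longleftrightarrow> X + Y < - (a + b)"
    "sgn (a + b - X - Y) = 1 \<longleftrightarrow> X + Y < a + b" "sgn (a + b - X - Y) = -1 \<longleftrightarrow> a + b < X + Y"
    by (auto simp: sgn_if)
  consider (in_range) "0 < b" "- (a + b) < X + Y" "X + Y < a + b"
    | (high) "0 < b" "a + b < X + Y" | (low) "0 < b" "X + Y < - (a + b)"
    | (neg) "b < 0" using c1 c2 p by fastforce
  then show ?thesis
  proof cases
    case in_range
    then have e: "sgn (a + b + X + Y) = 1" "sgn (a + b - X - Y) = 1" "sgn b = 1" using big by simp_all
    have "side a b X Y = sgn (2 * a + (X + Y))" "side a b (- X) (- Y) = sgn (2 * a - (X + Y))"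
      "side b a Y X = sgn (2 * b + (X + Y))" "side b a (- Y) (- X) = sgn (2 * b - (X + Y))"
      unfolding s e by (simp_all add: algebra_simps)
    moreover have "sgn (2 * a + w) + sgn (2 * a - w) + sgn (2 * b + w) + sgn (2 * b - w)
       = 2 + 2 * of_bool (\<bar>w\<bar> < 2 * a \<and> \<bar>w\<bar> < 2 * b)"
      if "0 < b" "- (a + b) < w" "w < a + b" "\<bar>w\<bar> \<noteq> 2 * a" "\<bar>w\<bar> \<noteq> 2 * b" for w
      using that a by (auto simp: sgn_if)
    moreover have "\<bar>X + Y\<bar> \<noteq> 2 * a" "\<bar>X + Y\<bar> \<noteq> 2 * b"
      using in_range n3[of a] n3[of b] by linarith+
    ultimately show ?thesis using in_range by (simp add: reduced_def)
  next
    case high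
    then have e: "sgn (a + b + X + Y) = 1" "sgn (a + b - X - Y) = -1" "sgn b = 1" using big a by simp_all
    have "side a b X Y = 1" "side a b (- X) (- Y) = sgn (Y - X)"
      "side b a Y X = 1" "side b a (- Y) (- X) = sgn (X - Y)"
      unfolding s e using high a by (simp_all add: sgn_1_pos)
    moreover have "\<not> reduced a b X Y" using high by (auto simp: reduced_def)
    ultimately show ?thesis using anti by simp
  next
    case low
    then have e: "sgn (a + b + X + Y) = -1" "sgn (a + b - X - Y) = 1" "sgn b = 1" using big a by simp_all
    have "side a b X Y = sgn (X - Y)" "side a b (- X) (- Y) = 1"
      "side b a Y X = sgn (Y - X)" "side b a (- Y) (- X) = 1"
      unfolding s e using low a by (simp_all add: sgn_1_pos)
    moreover have "\<not> reduced a b X Y" using low by (auto simp: reduced_def)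
    ultimately show ?thesis using anti by simp
  next
    case neg
    then have b: "sgn b = -1" by simp
    have n: "\<not> reduced a b X Y" using neg by (auto simp: reduced_def)
    have 1: "side a b X Y + side b a Y X = 1 + sgn (X - Y)"
    proof (cases "sgn (a + b + X + Y) = 1")
      case True
      have "side a b X Y = sgn (2 * a + (X + Y))" "side b a Y X = sgn (X - Y)"
        unfolding s b True by (simp_all add: algebra_simps)
      then show ?thesis using True big a neg by (simp add: sgn_1_pos)
    next
      case False
      then have F: "sgn (a + b + X + Y) = -1" using c1 by (auto simp: sgn_if split: if_splits)
      have "side a b X Y = sgn (X - Y)" "side b a Y X = sgn (- 2 * b - (X + Y))"
        unfolding s b F by (simp, intro arg_cong[of _ _ sgn], simp)
      then show ?thesis using F big a neg by (simp add: sgn_1_pos)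
    qed
    have 2: "side a b (- X) (- Y) + side b a (- Y) (- X) = 1 + sgn (Y - X)"
    proof (cases "sgn (a + b - X - Y) = 1")
      case True
      have "side a b (- X) (- Y) = sgn (2 * a - (X + Y))" "side b a (- Y) (- X) = sgn (Y - X)"
        unfolding s b True by (simp_all add: algebra_simps)
      then show ?thesis using True big a neg by (simp add: sgn_1_pos)
    next
      case False
      then have F: "sgn (a + b - X - Y) = -1" using c2 by (auto simp: sgn_if split: if_splits)
      have "side a b (- X) (- Y) = sgn (Y - X)" "side b a (- Y) (- X) = sgn (- 2 * b + (X + Y))"
        unfolding s b F by (simp, intro arg_cong[of _ _ sgn], simp)
      then show ?thesis using F big a neg by (simp add: sgn_1_pos)
    qed
    show ?thesis using 1 2 n anti by simp
  qed
qed

text \<open>By \<open>side_eq_or_bounded\<close> scaling changes the orientation of finitely many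
  tiles only, all of them in \<open>U\<close>. These tiles are permuted by the reflection, which
  negates both orientations and hence their difference, so the differences sum to zero.\<close>

lemma sum_side_scale:
  assumes m: "m mod 4 = 1" "0 < m" and pq: "p mod 4 = 1" "q mod 4 = 1" "0 < p" "0 < q"
    and U: "finite U" "U \<subseteq> tiles m" "\<And>t. t \<in> tiles m \<Longrightarrow> t \<in> {-(4*p*q*m)..4*p*q*m} \<times> {-(4*p*q*m)..4*p*q*m}
      \<times> {-(4*p*q*m)..4*p*q*m} \<times> {-(4*p*q*m)..4*p*q*m} \<Longrightarrow> t \<in> U"
  shows "(\<Sum>(a, b, X, Y) \<in> U. side a b X Y) = (\<Sum>(a, b, X, Y) \<in> U. side (p * a) (q * b) (p * X) (q * Y))"
proof -
  define d where "d = (\<lambda>(a, b, X, Y). side a b X Y - side (p * a) (q * b) (p * X) (q * Y))"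
  define S where "S = {t \<in> tiles m. d t \<noteq> 0}"
  have pqm: "p * q * m mod 4 = 1" "0 < p * q * m"
    using m pq by (auto simp: mod_mult_eq[symmetric])
  have "S \<subseteq> U"
  proof
    fix t assume t: "t \<in> S"
    obtain a b X Y where tt: "t = (a, b, X, Y)" by (cases t)
    have T: "(a, b, X, Y) \<in> tiles m" using t tt by (simp add: S_def)
    note T' = tiles_scale[OF T pq(1,2)]
    have le: "\<bar>z\<bar> \<le> p * \<bar>z\<bar>" "\<bar>z\<bar> \<le> q * \<bar>z\<bar>" for z :: int
      using pq mult_right_mono[of 1 p "\<bar>z\<bar>"] mult_right_mono[of 1 q "\<bar>z\<bar>"] by simp_all
    have "1 * m \<le> p * q * m" using pq m by (intro mult_right_mono) (auto simp: int_one_le_iff_zero_less)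
    then have le_m: "4 * m \<le> 4 * p * q * m" by simp
    have "p * a + p * X = p * (a + X)" by (simp add: algebra_simps)
    then have "sgn (p * a) * sgn (p * a + p * X) = sgn a * sgn (a + X)" using pq by (simp add: sgn_mult)
    moreover have "side a b X Y \<noteq> side (p * a) (q * b) (p * X) (q * Y)"
      using t tt by (auto simp: S_def d_def)
    ultimately have "(\<forall>z \<in> {a, b, X, Y}. \<bar>z\<bar> \<le> 4 * m) \<or>
        (\<forall>z \<in> {p * a, q * b, p * X, q * Y}. \<bar>z\<bar> \<le> 4 * (p * q * m))"
      using side_eq_or_bounded[OF T m] side_eq_or_bounded[OF T' pqm] by metis
    then have "\<bar>a\<bar> \<le> 4*p*q*m \<and> \<bar>b\<bar> \<le> 4*p*q*m \<and> \<bar>X\<bar> \<le> 4*p*q*m \<and> \<bar>Y\<bar> \<le> 4*p*q*m"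
    proof
      assume "\<forall>z \<in> {a, b, X, Y}. \<bar>z\<bar> \<le> 4 * m"
      then show ?thesis using le_m by auto
    next
      assume "\<forall>z \<in> {p * a, q * b, p * X, q * Y}. \<bar>z\<bar> \<le> 4 * (p * q * m)"
      then have "p * \<bar>a\<bar> \<le> 4*p*q*m" "q * \<bar>b\<bar> \<le> 4*p*q*m" "p * \<bar>X\<bar> \<le> 4*p*q*m" "q * \<bar>Y\<bar> \<le> 4*p*q*m"
        using pq by (simp_all add: abs_mult mult.assoc)
      then show ?thesis using le[of a] le[of b] le[of X] le[of Y] by linarith
    qed
    then show "t \<in> U" using U(3)[OF T] tt by (simp add: abs_le_iff)
  qed
  have flip: "(a, - 2 * Y - b, - 2 * a - X, Y) \<in> S"
    "d (a, - 2 * Y - b, - 2 * a - X, Y) = - d (a, b, X, Y)" if "(a, b, X, Y) \<in> S" for a b X Y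
  proof -
    have "side (p * a) (q * (- 2 * Y - b)) (p * (- 2 * a - X)) (q * Y) = - side (p * a) (q * b) (p * X) (q * Y)"
      using side_reflect[of "p * a" "q * Y" "q * b" "p * X"] by (simp add: algebra_simps)
    then show *: "d (a, - 2 * Y - b, - 2 * a - X, Y) = - d (a, b, X, Y)"
      unfolding d_def prod.case side_reflect by simp
    show "(a, - 2 * Y - b, - 2 * a - X, Y) \<in> S"
      using that tiles_reflect[of a b X Y m] * unfolding S_def by simp
  qed
  have "sum d S = sum (\<lambda>t. - d t) S"
  proof (rule sum.reindex_bij_witness[where i = "\<lambda>(a, b, X, Y). (a, - 2 * Y - b, - 2 * a - X, Y)"
        and j = "\<lambda>(a, b, X, Y). (a, - 2 * Y - b, - 2 * a - X, Y)"], goal_cases)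
    case (2 t) then show ?case using flip(1) by (cases t) auto
  next
    case (4 t) then show ?case using flip(1) by (cases t) auto
  next
    case (5 t)
    obtain a b X Y where "t = (a, b, X, Y)" by (cases t)
    then show ?case using 5 flip(2)[of a b X Y] by simp
  qed auto
  then have "sum d S = 0" by (simp add: sum_negf)
  moreover have "sum d U = sum d S"
    using U \<open>S \<subseteq> U\<close> by (intro sum.mono_neutral_right) (auto simp: S_def)
  ultimately have "sum d U = 0" by simp
  then show ?thesis by (simp add: d_def case_prod_unfold sum_subtractf)
qed

text \<open>A tile and its negative have the same orientations, so a < 0 reduces to a > 0; the sign
  of \<open>a\<close> decides which of the two may be reduced.\<close>

lemma sum_sides_symmetric:
  assumes t: "(a, b, X, Y) \<in> tiles m" and m: "m mod 4 = 1" "0 < m"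
  shows "side a b X Y + side a b (- X) (- Y) + side b a Y X + side b a (- Y) (- X)
    = 2 + 2 * of_bool (reduced a b X Y) + 2 * of_bool (reduced (- a) (- b) (- X) (- Y))"
proof (cases "0 < a")
  case True
  then have "\<not> reduced (- a) (- b) (- X) (- Y)" by (auto simp: reduced_def)
  then show ?thesis using sum_sides[OF t m True] by simp
next
  case False
  moreover have "odd a" using t by (auto simp: tiles_def)
  ultimately have "0 < - a" by presburger
  then have "side (- a) (- b) (- X) (- Y) + side (- a) (- b) (- (- X)) (- (- Y)) + side (- b) (- a) (- Y) (- X)
      + side (- b) (- a) (- (- Y)) (- (- X)) = 2 + 2 * of_bool (reduced (- a) (- b) (- X) (- Y))"
    by (rule sum_sides[OF tiles_neg[OF t] m])
  moreover have "\<not> reduced a b X Y" using False by (auto simp: reduced_def)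
  ultimately show ?thesis using side_neg[of a b X Y] side_neg[of a b "- X" "- Y"]
      side_neg[of b a Y X] side_neg[of b a "- Y" "- X"] by simp
qed

section \<open>Reduced binary forms of given determinant\<close>

definition reduced_forms :: "int \<Rightarrow> (int \<times> int \<times> int) set" where
  "reduced_forms k = {(a, b, w). odd a \<and> odd b \<and> even w \<and> \<bar>w\<bar> < a \<and> \<bar>w\<bar> < b \<and> a * b - w\<^sup>2 = k}"

text \<open>Writing a = \<bar>w\<bar> + 1 + x and b = \<bar>w\<bar> + 1 + y with x, y \<ge> 0
  reduces each inequality to the nonnegativity of products of x, y and \<bar>w\<bar>.\<close>

lemma reduced_bounds:
  fixes a b w :: int
  assumes "\<bar>w\<bar> < a" "\<bar>w\<bar> < b"
  shows "a \<le> a * b - w\<^sup>2 + \<bar>w\<bar>" "b \<le> a * b - w\<^sup>2 + \<bar>w\<bar>" "2 * \<bar>w\<bar> \<le> a * b - w\<^sup>2" "0 < a * b - w\<^sup>2"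
    "(b - \<bar>w\<bar>) * \<bar>w\<bar> \<le> a * b - w\<^sup>2"
proof -
  define v x y where "v = \<bar>w\<bar>" and "x = a - \<bar>w\<bar> - 1" and "y = b - \<bar>w\<bar> - 1"
  have nn: "0 \<le> v" "0 \<le> x" "0 \<le> y" using assms by (auto simp: v_def x_def y_def)
  have ab: "a = x + v + 1" "b = y + v + 1" by (simp_all add: v_def x_def y_def)
  have w2: "w\<^sup>2 = v * v" by (simp add: v_def power2_eq_square)
  have prods: "0 \<le> x * y" "0 \<le> v * x" "0 \<le> v * y" using nn by simp_all
  show "a \<le> a * b - w\<^sup>2 + \<bar>w\<bar>" "b \<le> a * b - w\<^sup>2 + \<bar>w\<bar>" "2 * \<bar>w\<bar> \<le> a * b - w\<^sup>2" "0 < a * b - w\<^sup>2"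
    "(b - \<bar>w\<bar>) * \<bar>w\<bar> \<le> a * b - w\<^sup>2"
    unfolding w2 v_def[symmetric] unfolding ab by (simp_all add: algebra_simps; use nn prods in linarith)+
qed

lemma finite_reduced_forms: "finite (reduced_forms k)"
proof (rule finite_subset)
  show "reduced_forms k \<subseteq> {0..2 * k} \<times> {0..2 * k} \<times> {-k..k}"
  proof
    fix t assume "t \<in> reduced_forms k"
    then obtain a b w where t: "t = (a, b, w)" "\<bar>w\<bar> < a" "\<bar>w\<bar> < b" "a * b - w\<^sup>2 = k"
      by (auto simp: reduced_forms_def)
    then show "t \<in> {0..2 * k} \<times> {0..2 * k} \<times> {-k..k}"
      using reduced_bounds[OF t(2,3)] by (auto simp: abs_le_iff)
  qed
qed simp

lemma reduced_forms_nonpos: "k \<le> 0 \<Longrightarrow> reduced_forms k = {}"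
  using reduced_bounds(4) by (fastforce simp: reduced_forms_def)

lemma card_odd_interval:
  fixes a :: int
  assumes "odd a" "0 < a"
  shows "int (card {j. 2 * \<bar>j\<bar> < a}) = a"
proof -
  obtain c where c: "a = 2 * c + 1" using assms by (auto elim: oddE)
  have "{j. 2 * \<bar>j\<bar> < a} = {-c..c}" using c by auto
  then show ?thesis using c assms by simp
qed

section \<open>Counting reduced tiles by scaling a row\<close>

locale odd_det =
  fixes m :: int
  assumes m: "m mod 4 = 1" "0 < m"
begin

text \<open>The bound is 4 * p * q * m from \<open>sum_side_scale\<close> with p * q = 9 * m, so the
  same box serves for scaling either row by 9 * m. The factor 9 is 1 modulo 4 and large enough for
  \<open>reduced_scaled_iff\<close>.\<close>

definition box :: "(int \<times> int \<times> int \<times> int) set" where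
  "box = {(a, b, X, Y) \<in> tiles m. \<bar>a\<bar> \<le> 36 * m * m \<and> \<bar>b\<bar> \<le> 36 * m * m \<and> \<bar>X\<bar> \<le> 36 * m * m \<and> \<bar>Y\<bar> \<le> 36 * m * m}"

lemma finite_box: "finite box"
proof (rule finite_subset)
  let ?I = "{-(36 * m * m)..36 * m * m}"
  show "box \<subseteq> ?I \<times> ?I \<times> ?I \<times> ?I" by (auto simp: box_def)
qed simp

lemma sum_box_conj:
  "(\<Sum>(a, b, X, Y) \<in> box. G a b (- X) (- Y)) = (\<Sum>(a, b, X, Y) \<in> box. G a b X Y)"
  by (rule sum.reindex_bij_witness[where i = "\<lambda>(a, b, X, Y). (a, b, - X, - Y)" and j = "\<lambda>(a, b, X, Y). (a, b, - X, - Y)"])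
    (auto simp: box_def intro: tiles_conj)

lemma sum_box_swap:
  "(\<Sum>(a, b, X, Y) \<in> box. G b a Y X) = (\<Sum>(a, b, X, Y) \<in> box. G a b X Y)"
  by (rule sum.reindex_bij_witness[where i = "\<lambda>(a, b, X, Y). (b, a, Y, X)" and j = "\<lambda>(a, b, X, Y). (b, a, Y, X)"])
    (auto simp: box_def intro: tiles_swap)

lemma sum_box_neg:
  "(\<Sum>(a, b, X, Y) \<in> box. G (- a) (- b) (- X) (- Y)) = (\<Sum>(a, b, X, Y) \<in> box. G a b X Y)"
  by (rule sum.reindex_bij_witness[where i = "\<lambda>(a, b, X, Y). (- a, - b, - X, - Y)" and j = "\<lambda>(a, b, X, Y). (- a, - b, - X, - Y)"])
    (auto simp: box_def intro: tiles_neg)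

lemma sum_box_side_scale:
  assumes "p mod 4 = 1" "q mod 4 = 1" "0 < p" "0 < q" "p * q = 9 * m"
  shows "(\<Sum>(a, b, X, Y) \<in> box. side a b X Y) = (\<Sum>(a, b, X, Y) \<in> box. side (p * a) (q * b) (p * X) (q * Y))"
proof (rule sum_side_scale[OF m assms(1-4) finite_box])
  show "box \<subseteq> tiles m" by (auto simp: box_def)
  have e: "4 * p * q * m = 36 * m * m" using assms(5) by (simp add: mult.assoc)
  show "t \<in> box" if "t \<in> tiles m" "t \<in> {-(4*p*q*m)..4*p*q*m} \<times> {-(4*p*q*m)..4*p*q*m}
      \<times> {-(4*p*q*m)..4*p*q*m} \<times> {-(4*p*q*m)..4*p*q*m}" for t
    using that unfolding e by (cases t) (auto simp: box_def abs_le_iff)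
qed

text \<open>Sums \<open>sum_sides_symmetric\<close> over the box. Since the box is closed under
  negation, the tiles that are reduced and those whose negative is reduced are equally many, whence
  the factor 4.\<close>

lemma sum_box_sides:
  assumes "k mod 4 = 1" "0 < k" "\<And>a b X Y. (a, b, X, Y) \<in> tiles m \<Longrightarrow> (a, q * b, X, q * Y) \<in> tiles k"
  shows "(\<Sum>(a, b, X, Y) \<in> box. side a (q * b) X (q * Y)) + (\<Sum>(a, b, X, Y) \<in> box. side a (q * b) (- X) (- (q * Y)))
      + (\<Sum>(a, b, X, Y) \<in> box. side (q * b) a (q * Y) X) + (\<Sum>(a, b, X, Y) \<in> box. side (q * b) a (- (q * Y)) (- X))
    = 2 * int (card box) + 4 * int (card {(a, b, X, Y) \<in> box. reduced a (q * b) X (q * Y)})"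
proof -
  have "(\<Sum>(a, b, X, Y) \<in> box. side a (q * b) X (q * Y)) + (\<Sum>(a, b, X, Y) \<in> box. side a (q * b) (- X) (- (q * Y)))
      + (\<Sum>(a, b, X, Y) \<in> box. side (q * b) a (q * Y) X) + (\<Sum>(a, b, X, Y) \<in> box. side (q * b) a (- (q * Y)) (- X))
    = (\<Sum>(a, b, X, Y) \<in> box. 2 + 2 * of_bool (reduced a (q * b) X (q * Y))
        + 2 * of_bool (reduced (- a) (q * - b) (- X) (q * - Y)))"
    unfolding sum.distrib[symmetric]
  proof (rule sum.cong[OF refl])
    fix t assume t: "t \<in> box"
    obtain a b X Y where tt: "t = (a, b, X, Y)" by (cases t)
    have "(a, q * b, X, q * Y) \<in> tiles k" using t tt assms(3) by (simp add: box_def)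
    from sum_sides_symmetric[OF this assms(1,2)]
    show "(case t of (a, b, X, Y) \<Rightarrow> side a (q * b) X (q * Y)) + (case t of (a, b, X, Y) \<Rightarrow> side a (q * b) (- X) (- (q * Y)))
      + (case t of (a, b, X, Y) \<Rightarrow> side (q * b) a (q * Y) X) + (case t of (a, b, X, Y) \<Rightarrow> side (q * b) a (- (q * Y)) (- X))
      = (case t of (a, b, X, Y) \<Rightarrow> 2 + 2 * of_bool (reduced a (q * b) X (q * Y))
        + 2 * of_bool (reduced (- a) (q * - b) (- X) (q * - Y)))"
      by (simp add: tt)
  qed
  also have "\<dots> = 2 * int (card box) + 2 * (\<Sum>(a, b, X, Y) \<in> box. of_bool (reduced a (q * b) X (q * Y)))
      + 2 * (\<Sum>(a, b, X, Y) \<in> box. of_bool (reduced (- a) (q * - b) (- X) (q * - Y)))"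
    by (simp add: case_prod_unfold sum.distrib sum_distrib_left)
  also have "(\<Sum>(a, b, X, Y) \<in> box. of_bool (reduced (- a) (q * - b) (- X) (q * - Y)))
      = (\<Sum>(a, b, X, Y) \<in> box. of_bool (reduced a (q * b) X (q * Y)) :: int)"
    by (rule sum_box_neg)
  also have "(\<Sum>(a, b, X, Y) \<in> box. of_bool (reduced a (q * b) X (q * Y)) :: int)
      = int (card {(a, b, X, Y) \<in> box. reduced a (q * b) X (q * Y)})"
  proof -
    have "(\<Sum>(a, b, X, Y) \<in> box. of_bool (reduced a (q * b) X (q * Y)) :: int)
        = (\<Sum>t \<in> box. if t \<in> {(a, b, X, Y) \<in> box. reduced a (q * b) X (q * Y)} then 1 else 0)"
      by (rule sum.cong) auto
    also have "\<dots> = int (card {(a, b, X, Y) \<in> box. reduced a (q * b) X (q * Y)})"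
      using finite_box by (subst sum.inter_restrict[symmetric]) (auto intro!: arg_cong[of _ _ card])
    finally show ?thesis .
  qed
  finally show ?thesis by simp
qed

text \<open>By the symmetries of the box and the invariance under scaling, each of the four edge
  sums equals the unscaled sum of \<open>side\<close>, with or without the factor 9 * m. Comparing
  the two instances of \<open>sum_box_sides\<close> leaves the two counts.\<close>

lemma card_reduced_scale:
  "card {(a, b, X, Y) \<in> box. reduced a b X Y} = card {(a, b, X, Y) \<in> box. reduced a (9 * m * b) X (9 * m * Y)}"
proof -
  define T where "T = 9 * m"
  have T: "T mod 4 = 1" "0 < T" "1 * T = 9 * m" "T * 1 = 9 * m" using m unfolding T_def by presburger+
  let ?S = "\<Sum>(a, b, X, Y) \<in> box. side a b X Y"
  have 1: "?S = (\<Sum>(a, b, X, Y) \<in> box. side a (T * b) X (T * Y))"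
    using sum_box_side_scale[OF _ T(1) _ T(2,3)] by simp
  \<comment> \<open>Exchanging \<open>a\<close> with \<open>b\<close> exchanges the rows, so the two
    edges attached to \<open>b\<close> need the invariance under scaling of the first row.\<close>
  have 2: "?S = (\<Sum>(a, b, X, Y) \<in> box. side (T * a) b (T * X) Y)"
    using sum_box_side_scale[OF T(1) _ T(2) _ T(4)] by simp
  have 3: "(\<Sum>(a, b, X, Y) \<in> box. side (T * b) a (T * Y) X) = ?S"
    unfolding 2 by (rule sum_box_swap[of "\<lambda>a b X Y. side (T * a) b (T * X) Y"])
  have 4: "(\<Sum>(a, b, X, Y) \<in> box. side a (T * b) (- X) (- (T * Y))) = ?S"
    unfolding 1 using sum_box_conj[of "\<lambda>a b X Y. side a (T * b) X (T * Y)"] by simp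
  have 5: "(\<Sum>(a, b, X, Y) \<in> box. side (T * b) a (- (T * Y)) (- X)) = ?S"
    unfolding 3[symmetric] using sum_box_conj[of "\<lambda>a b X Y. side (T * b) a (T * Y) X"] by simp
  have T': "T * m mod 4 = 1" "0 < T * m" using T m by (auto simp: mod_mult_eq[symmetric])
  have "4 * ?S = 2 * int (card box) + 4 * int (card {(a, b, X, Y) \<in> box. reduced a (T * b) X (T * Y)})"
    using sum_box_sides[OF T', of T] tiles_scale[of _ _ _ _ m 1 T] T(1) 1[symmetric] 3 4 5 by simp
  moreover have "4 * ?S = 2 * int (card box) + 4 * int (card {(a, b, X, Y) \<in> box. reduced a b X Y})"
    using sum_box_sides[OF m, of 1] sum_box_conj[of side] sum_box_swap[of side]
      sum_box_conj[of "\<lambda>a b X Y. side b a Y X"] by simp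
  ultimately show ?thesis by (simp add: T_def)
qed

text \<open>With w = (X + Y) / 2 and i = (Y - X) / 2 the determinant is (a * b - w^2) + i^2. It is
  positive for reduced tiles, hence equal to \<open>m\<close> with 4 dividing X + Y, which makes
  \<open>w\<close> and then \<open>i\<close> even.\<close>

lemma card_reduced_box:
  "int (card {(a, b, X, Y) \<in> box. reduced a b X Y}) = (\<Sum>i \<in> {i \<in> {-m..m}. even i}. int (card (reduced_forms (m - i\<^sup>2))))"
proof -
  let ?I = "{i \<in> {-m..m}. even i}"
  have mm: "m \<le> m * m" using m mult_left_mono[of 1 m m] by simp
  have "bij_betw (\<lambda>(a, b, X, Y). ((Y - X) div 2, a, b, (X + Y) div 2)) {(a, b, X, Y) \<in> box. reduced a b X Y}
    (Sigma ?I (\<lambda>i. reduced_forms (m - i\<^sup>2)))"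
  proof (rule bij_betw_byWitness[where f' = "\<lambda>(i, a, b, w). (a, b, w - i, w + i)"])
    show "\<forall>t \<in> {(a, b, X, Y) \<in> box. reduced a b X Y}.
        (\<lambda>(i, a, b, w). (a, b, w - i, w + i)) ((\<lambda>(a, b, X, Y). ((Y - X) div 2, a, b, (X + Y) div 2)) t) = t"
      by (auto simp: box_def tiles_def elim!: evenE)
    show "\<forall>t \<in> Sigma ?I (\<lambda>i. reduced_forms (m - i\<^sup>2)).
        (\<lambda>(a, b, X, Y). ((Y - X) div 2, a, b, (X + Y) div 2)) ((\<lambda>(i, a, b, w). (a, b, w - i, w + i)) t) = t"
      by auto
    show "(\<lambda>(a, b, X, Y). ((Y - X) div 2, a, b, (X + Y) div 2)) ` {(a, b, X, Y) \<in> box. reduced a b X Y}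
        \<subseteq> Sigma ?I (\<lambda>i. reduced_forms (m - i\<^sup>2))"
    proof (rule image_subsetI)
      fix t' assume t': "t' \<in> {(a, b, X, Y) \<in> box. reduced a b X Y}"
      obtain a b X Y where tt: "t' = (a, b, X, Y)" by (cases t')
      have t: "(a, b, X, Y) \<in> box" and r: "reduced a b X Y" using t' tt by auto
      then have p: "odd a" "odd b" "even X" "even Y" by (auto simp: box_def tiles_def)
      obtain x y where xy: "X = 2 * x" "Y = 2 * y" using p by (auto elim!: evenE)
      define w i where "w = x + y" and "i = y - x"
      have w: "(Y - X) div 2 = i" "(X + Y) div 2 = w" "X * Y = w\<^sup>2 - i\<^sup>2" "X + Y = 2 * w"
        unfolding w_def i_def xy by (simp_all add: power2_eq_square algebra_simps)
      have wb: "\<bar>w\<bar> < a" "\<bar>w\<bar> < b" using r by (auto simp: reduced_def w)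
      have "0 < a * b - w\<^sup>2" by (rule reduced_bounds[OF wb])
      then have "0 < a * b - X * Y" using zero_le_power2[of i] unfolding w by linarith
      then have det: "a * b - X * Y = m" "4 dvd X + Y" using t m by (auto simp: box_def tiles_def)
      then have "even w" unfolding w by presburger
      moreover then have "even i" unfolding w_def i_def by simp
      moreover have eq: "a * b - w\<^sup>2 = m - i\<^sup>2" using det w by simp
      moreover have "\<bar>i\<bar> \<le> m" using eq \<open>0 < a * b - w\<^sup>2\<close> abs_le_power2[of i] by linarith
      ultimately show "(\<lambda>(a, b, X, Y). ((Y - X) div 2, a, b, (X + Y) div 2)) t' \<in> Sigma ?I (\<lambda>i. reduced_forms (m - i\<^sup>2))"
        using p wb unfolding tt prod.case w by (auto simp: reduced_forms_def abs_le_iff)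
    qed
    show "(\<lambda>(i, a, b, w). (a, b, w - i, w + i)) ` Sigma ?I (\<lambda>i. reduced_forms (m - i\<^sup>2))
        \<subseteq> {(a, b, X, Y) \<in> box. reduced a b X Y}"
    proof (rule image_subsetI)
      fix t' assume t': "t' \<in> Sigma ?I (\<lambda>i. reduced_forms (m - i\<^sup>2))"
      obtain i a b w where tt: "t' = (i, a, b, w)" by (cases t')
      have i: "i \<in> {-m..m}" "even i" and f: "(a, b, w) \<in> reduced_forms (m - i\<^sup>2)" using t' tt by auto
      then have f': "odd a" "odd b" "even w" "\<bar>w\<bar> < a" "\<bar>w\<bar> < b" "a * b - w\<^sup>2 = m - i\<^sup>2"
        by (auto simp: reduced_forms_def)
      have bd: "\<bar>i\<bar> \<le> m" "2 * \<bar>w\<bar> \<le> m" "a \<le> 2 * m" "b \<le> 2 * m"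
        using i reduced_bounds[OF f'(4,5)] zero_le_power2[of i] unfolding f'(6) atLeastAtMost_iff by - linarith+
      have "4 dvd w - i + (w + i)" using f'(3) by (auto elim!: evenE)
      moreover have "a * b - (w - i) * (w + i) = m" using f'(6) by (simp add: power2_eq_square algebra_simps)
      ultimately have "(a, b, w - i, w + i) \<in> tiles m" using f' i by (simp add: tiles_def)
      moreover have "\<bar>w - i\<bar> \<le> 2 * m" "\<bar>w + i\<bar> \<le> 2 * m" using bd by linarith+
      moreover have "2 * m \<le> 36 * m * m" using mm m by simp
      ultimately have "(a, b, w - i, w + i) \<in> box" using bd f'(4,5) unfolding box_def by auto
      moreover have "reduced a b (w - i) (w + i)" using f'(4,5) by (simp add: reduced_def abs_mult)
      ultimately show "(\<lambda>(i, a, b, w). (a, b, w - i, w + i)) t' \<in> {(a, b, X, Y) \<in> box. reduced a b X Y}"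
        unfolding tt by simp
    qed
  qed
  then have "card {(a, b, X, Y) \<in> box. reduced a b X Y} = card (Sigma ?I (\<lambda>i. reduced_forms (m - i\<^sup>2)))"
    by (rule bij_betw_same_card)
  also have "\<dots> = (\<Sum>i \<in> ?I. card (reduced_forms (m - i\<^sup>2)))"
    by (rule card_SigmaI, rule finite_subset[of _ "{-m..m}"]) (auto simp: finite_reduced_forms)
  finally show ?thesis by simp
qed

text \<open>These are Hermite normal forms. If \<open>Y\<close> were nonzero, \<bar>w\<bar> would be
  at least 9 * m, which brings T * b close to \<bar>w\<bar> and so to T * \<bar>Y\<bar>, with an
  error below \<open>T\<close>. Then \<open>b\<close> is \<open>Y\<close> or - Y, although
  \<open>b\<close> is odd and \<open>Y\<close> even.\<close>

lemma reduced_scaled_iff: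
  "(a, b, X, Y) \<in> box \<and> reduced a (9 * m * b) X (9 * m * Y) \<longleftrightarrow>
    Y = 0 \<and> (a, b) \<in> divisor_pairs m \<and> 4 dvd X \<and> \<bar>X\<bar> < 2 * a"
  (is "?L \<longleftrightarrow> ?R")
proof
  have mm: "m \<le> m * m" using m mult_left_mono[of 1 m m] by simp
  assume R: ?R
  then have ab: "0 < a" "0 < b" "a * b = m" by (auto simp: divisor_pairs_def)
  have "a * 1 \<le> a * b" "1 * b \<le> a * b" using ab by (intro mult_left_mono mult_right_mono; simp)+
  then have le: "a \<le> m" "b \<le> m" using ab by simp_all
  have "odd m" using m by presburger
  then have "odd a" "odd b" using ab(3) by auto
  moreover have "even X" using R by (meson dvd_trans even_numeral)
  ultimately have "(a, b, X, Y) \<in> tiles m" using R ab(3) by (simp add: tiles_def)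
  moreover have X: "\<bar>X\<bar> < 2 * m" using R le by linarith
  moreover have "2 * m \<le> 36 * m * m" using mm m by simp
  ultimately have "\<bar>a\<bar> \<le> 36 * m * m" "\<bar>b\<bar> \<le> 36 * m * m" "\<bar>X\<bar> \<le> 36 * m * m"
    "\<bar>Y\<bar> \<le> 36 * m * m" "(a, b, X, Y) \<in> tiles m"
    using R ab(1,2) le m(2) by - (linarith | simp)+
  then have "(a, b, X, Y) \<in> box" by (simp add: box_def)
  moreover have "9 * m * 1 \<le> 9 * m * b" using ab m by (intro mult_left_mono) auto
  then have "\<bar>X\<bar> < 2 * (9 * m * b)" using X m(2) by linarith
  ultimately show ?L using R by (simp add: reduced_def)
next
  assume L: ?L
  define T where "T = 9 * m"
  have T: "odd T" "0 < T" using m unfolding T_def by presburger+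
  have p: "odd a" "odd b" "even X" "even Y" using L by (auto simp: box_def tiles_def)
  obtain x y where xy: "X = 2 * x" "Y = 2 * y" using p by (auto elim!: evenE)
  define w i where "w = x + T * y" and "i = T * y - x"
  have w: "X + T * Y = 2 * w" "T * (X * Y) = w\<^sup>2 - i\<^sup>2" "T * Y = w + i"
    unfolding w_def i_def xy by (simp_all add: power2_eq_square algebra_simps)
  have wb: "\<bar>w\<bar> < a" "\<bar>w\<bar> < T * b" using L w(1) by (auto simp: reduced_def T_def)
  note rb = reduced_bounds[OF wb]
  have det: "a * (T * b) - w\<^sup>2 = T * (a * b - X * Y) - i\<^sup>2" using w(2) by (simp add: algebra_simps)
  then have "0 < T * (a * b - X * Y)" using rb(4) zero_le_power2[of i] by linarith
  then have "0 < a * b - X * Y" using T(2) by (simp add: zero_less_mult_iff)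
  then have abm: "a * b - X * Y = m" "4 dvd X + Y" using L m by (auto simp: box_def tiles_def)
  have det': "a * (T * b) - w\<^sup>2 = 9 * m\<^sup>2 - i\<^sup>2" using det abm by (simp add: T_def power2_eq_square)
  have "\<bar>i\<bar>\<^sup>2 < (3 * m)\<^sup>2" using rb(4) det' by simp
  then have ib: "\<bar>i\<bar> < 3 * m" by (rule power2_less_imp_less) (use m in simp)
  have "Y = 0"
  proof (rule ccontr)
    assume "Y \<noteq> 0"
    then have "2 \<le> \<bar>Y\<bar>" using p by presburger
    then have "T * 2 \<le> T * \<bar>Y\<bar>" using T by (intro mult_left_mono) auto
    then have "2 * T \<le> \<bar>w + i\<bar>" using T w(3) by (metis abs_mult abs_of_pos mult.commute)
    then have wl: "9 * m \<le> \<bar>w\<bar>" using ib unfolding T_def by linarith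
    define y' where "y' = T * b - \<bar>w\<bar>"
    have y': "0 < y'" using wb by (simp add: y'_def)
    \<comment> \<open>The product y' * \<bar>w\<bar> is at most the scaled determinant, itself at
      most 9 * m^2; so a large \<bar>w\<bar> leaves \<open>y'\<close> at most
      \<open>m\<close>.\<close>
    have "y' * (9 * m) \<le> y' * \<bar>w\<bar>" using wl y' by (intro mult_left_mono) auto
    also have "\<dots> \<le> 9 * m\<^sup>2" using rb(5) det' zero_le_power2[of i] unfolding y'_def by linarith
    finally have "y' * (9 * m) \<le> m * (9 * m)" by (simp add: power2_eq_square)
    then have ym: "y' \<le> m" using m by simp
    define s where "s = (if 0 \<le> w then 1 else -1 :: int)"
    have "T * (b - s * Y) = y' + \<bar>w\<bar> - s * (w + i)" unfolding y'_def w(3)[symmetric] by (simp add: algebra_simps)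
    also have "\<dots> = y' - s * i" by (simp add: s_def algebra_simps)
    finally have e: "T * (b - s * Y) = y' - s * i" .
    have "\<bar>y' - s * i\<bar> < T" using y' ym ib m unfolding T_def s_def by auto
    then have "T * \<bar>b - s * Y\<bar> < T * 1" using e T by (metis abs_mult abs_of_pos mult.right_neutral)
    then have "\<bar>b - s * Y\<bar> < 1" using T by (simp only: mult_less_cancel_left_pos)
    then have "b = s * Y" by simp
    then show False using p by (auto simp: s_def split: if_splits)
  qed
  then show ?R using abm L wb T by (auto simp: divisor_pairs_def reduced_def zero_less_mult_iff T_def)
qed

text \<open>In a normal form X = 4 * j with 2 * \<bar>j\<bar> < a, and as \<open>a\<close> is odd
  this allows exactly \<open>a\<close> values. The total is the divisor sum of
  \<open>m\<close>.\<close>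

lemma sum_card_reduced_forms:
  "(\<Sum>i \<in> {i \<in> {-m..m}. even i}. int (card (reduced_forms (m - i\<^sup>2)))) = (\<Sum>(a, b) \<in> divisor_pairs m. a)"
proof -
  let ?J = "\<lambda>t :: int \<times> int. {j :: int. 2 * \<bar>j\<bar> < fst t}"
  have "(\<Sum>i \<in> {i \<in> {-m..m}. even i}. int (card (reduced_forms (m - i\<^sup>2))))
      = int (card {(a, b, X, Y) \<in> box. reduced a (9 * m * b) X (9 * m * Y)})"
    using card_reduced_box card_reduced_scale by simp
  also have "card {(a, b, X, Y) \<in> box. reduced a (9 * m * b) X (9 * m * Y)} = card (Sigma (divisor_pairs m) ?J)"
  proof (rule bij_betw_same_card[of "\<lambda>(a, b, X, Y). ((a, b), X div 4)"],
      rule bij_betw_byWitness[where f' = "\<lambda>((a, b), j). (a, b, 4 * j, 0)"])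
  qed (auto simp: reduced_scaled_iff)
  also have "\<dots> = (\<Sum>t \<in> divisor_pairs m. card (?J t))"
  proof (rule card_SigmaI)
    have "?J t \<subseteq> {- fst t..fst t}" for t by auto
    then show "\<forall>t \<in> divisor_pairs m. finite (?J t)" using finite_subset by blast
  qed (rule finite_divisor_pairs)
  also have "int \<dots> = (\<Sum>t \<in> divisor_pairs m. fst t)"
    unfolding of_nat_sum
  proof (rule sum.cong[OF refl])
    fix t assume t: "t \<in> divisor_pairs m"
    have "odd m" using m by presburger
    then have "odd (fst t)" "0 < fst t" using t by (auto simp: divisor_pairs_def)
    then show "int (card (?J t)) = fst t" by (rule card_odd_interval)
  qed
  finally show ?thesis by (simp add: case_prod_unfold)
qed

end

section \<open>Sums of three squares\<close>

definition odd_even_even :: "int \<Rightarrow> (int \<times> int \<times> int) set" where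
  "odd_even_even k = {(x, y, z). odd x \<and> even y \<and> even z \<and> x\<^sup>2 + y\<^sup>2 + z\<^sup>2 = k}"

lemma finite_odd_even_even: "finite (odd_even_even k)"
  by (rule finite_subset[OF _ finite_sum_of_squares(2)[of k]]) (auto simp: odd_even_even_def)

lemma odd_even_even_nonpos: "k \<le> 0 \<Longrightarrow> odd_even_even k = {}"
proof -
  assume k: "k \<le> 0"
  have False if "odd x" "x\<^sup>2 + y\<^sup>2 + z\<^sup>2 = k" for x y z
  proof -
    have "x \<noteq> 0" using that(1) by auto
    then have "0 < x\<^sup>2" by simp
    then show False using that k zero_le_power2[of y] zero_le_power2[of z] by linarith
  qed
  then show ?thesis by (auto simp: odd_even_even_def)
qed

lemma square_mod_4: "x\<^sup>2 mod 4 = (if even x then 0 else 1)" for x :: int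
proof (cases "even x")
  case True
  then show ?thesis by (auto elim!: evenE simp: power_mult_distrib)
next
  case False
  then obtain k where "x = 2 * k + 1" by (auto elim: oddE)
  then have "x\<^sup>2 = 1 + 4 * (k * k + k)" by (simp add: power2_eq_square algebra_simps)
  then have "x\<^sup>2 mod 4 = 1" by presburger
  then show ?thesis using False by simp
qed

lemma square_mod_8: "odd x \<Longrightarrow> x\<^sup>2 mod 8 = 1" for x :: int
proof -
  assume "odd x"
  then obtain k where "x = 2 * k + 1" by (auto elim: oddE)
  then have x: "x\<^sup>2 = 1 + 4 * (k * (k + 1))" by (simp add: power2_eq_square algebra_simps)
  have "even (k * (k + 1))" by simp
  then obtain l where "k * (k + 1) = 2 * l" by blast
  then have "x\<^sup>2 = 1 + 8 * l" using x by simp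
  then show ?thesis by simp
qed

lemma r4_odd:
  assumes "0 < m" "odd m"
  shows "r4 m = 8 * (\<Sum>(a, b) \<in> divisor_pairs m. a)"
proof -
  have "signed_sigma m = (\<Sum>(d, e) \<in> divisor_pairs m. e)"
    unfolding signed_sigma_def
    by (rule sum.cong) (use assms(2) in \<open>auto simp: divisor_pairs_def sg_def\<close>)
  also have "\<dots> = (\<Sum>(a, b) \<in> divisor_pairs m. a)"
    by (rule sum.reindex_bij_witness[where i = "\<lambda>(a, b). (b, a)" and j = "\<lambda>(a, b). (b, a)"])
      (auto simp: divisor_pairs_def)
  finally show ?thesis using r4_formula[OF assms(1)] assms(2) by (simp add: sg_def)
qed

text \<open>Modulo 4 the sum counts the odd coordinates, so exactly one of the four is odd, and its
  position gives the factor 4. \<open>A\<close> has it in second place and is then grouped by its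
  even first coordinate.\<close>

lemma card_four_squares_split:
  assumes m: "m mod 4 = 1"
  shows "r4 m = 4 * (\<Sum>i \<in> {i \<in> {-m..m}. even i}. int (card (odd_even_even (m - i\<^sup>2))))"
proof -
  let ?I = "{i \<in> {-m..m}. even i}"
  let ?R = "{(x, y, z, w). x\<^sup>2 + y\<^sup>2 + z\<^sup>2 + w\<^sup>2 = m}"
  define A where "A = {(i, x, y, z). even i \<and> odd x \<and> even y \<and> even z \<and> i\<^sup>2 + x\<^sup>2 + y\<^sup>2 + z\<^sup>2 = m}"
  define A1 where "A1 = (\<lambda>(i, x, y, z). (x, i, y, z)) ` A"
  define A2 where "A2 = (\<lambda>(i, x, y, z). (i, y, x, z)) ` A"
  define A3 where "A3 = (\<lambda>(i, x, y, z). (i, z, y, x)) ` A"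
  have AR: "A \<subseteq> ?R" by (auto simp: A_def)
  then have fA: "finite A" by (rule finite_subset) simp
  have mem: "(x, y, z, w) \<in> A1 \<longleftrightarrow> (y, x, z, w) \<in> A" "(x, y, z, w) \<in> A2 \<longleftrightarrow> (x, z, y, w) \<in> A"
    "(x, y, z, w) \<in> A3 \<longleftrightarrow> (x, w, z, y) \<in> A" for x y z w
    unfolding A1_def A2_def A3_def by force+
  have cards: "card A1 = card A" "card A2 = card A" "card A3 = card A"
    unfolding A1_def A2_def A3_def by (intro card_image; auto simp: inj_on_def)+
  have fin: "finite A1" "finite A2" "finite A3" using fA by (simp_all add: A1_def A2_def A3_def)
  have "?R = A \<union> A1 \<union> A2 \<union> A3"
  proof (intro equalityI subsetI)
    fix t assume t: "t \<in> ?R"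
    obtain x y z w where tt: "t = (x, y, z, w)" by (cases t)
    have s: "x\<^sup>2 + y\<^sup>2 + z\<^sup>2 + w\<^sup>2 = m" using t tt by simp
    have e: "\<exists>k. p\<^sup>2 = (if even p then 0 else 1) + 4 * k" for p :: int
      using mod_mult_div_eq[of "p\<^sup>2" 4] by (metis square_mod_4)
    obtain k1 k2 k3 k4 where k: "x\<^sup>2 = (if even x then 0 else 1) + 4 * k1" "y\<^sup>2 = (if even y then 0 else 1) + 4 * k2"
      "z\<^sup>2 = (if even z then 0 else 1) + 4 * k3" "w\<^sup>2 = (if even w then 0 else 1) + 4 * k4" using e by metis
    have "m = ((if even x then 0 else 1) + (if even y then 0 else 1) + (if even z then 0 else 1) + (if even w then 0 else 1))
        + 4 * (k1 + k2 + k3 + k4)"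
      unfolding s[symmetric] k by (simp only: algebra_simps)
    then have "((if even x then 0 else 1) + (if even y then 0 else 1) + (if even z then 0 else 1)
        + (if even w then 0 else 1)) mod 4 = (1 :: int)"
      using m by (metis mod_mult_self2)
    then have "(odd x \<and> even y \<and> even z \<and> even w) \<or> (even x \<and> odd y \<and> even z \<and> even w)
        \<or> (even x \<and> even y \<and> odd z \<and> even w) \<or> (even x \<and> even y \<and> even z \<and> odd w)"
      by (simp split: if_splits)
    then show "t \<in> A \<union> A1 \<union> A2 \<union> A3" unfolding tt Un_iff mem using s
      by (auto simp: A_def algebra_simps)
  next
    fix t assume t: "t \<in> A \<union> A1 \<union> A2 \<union> A3"
    obtain x y z w where tt: "t = (x, y, z, w)" by (cases t)
    show "t \<in> ?R" using t unfolding tt Un_iff mem by (auto simp: A_def algebra_simps)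
  qed
  moreover have "card (A \<union> A1 \<union> A2 \<union> A3) = card A + card A1 + card A2 + card A3"
  proof -
    have d: "A \<inter> A1 = {}" "(A \<union> A1) \<inter> A2 = {}" "(A \<union> A1 \<union> A2) \<inter> A3 = {}"
      by (auto simp: mem) (auto simp: A_def)
    show ?thesis using fA fin d by (simp add: card_Un_disjoint)
  qed
  ultimately have "card ?R = 4 * card A" using cards by simp
  moreover have "card A = (\<Sum>i \<in> ?I. card (odd_even_even (m - i\<^sup>2)))"
  proof -
    have "\<bar>i\<bar> \<le> m" if "i\<^sup>2 + x\<^sup>2 + y\<^sup>2 + z\<^sup>2 = m" for i x y z
      using that abs_le_power2[of i] zero_le_power2[of x] zero_le_power2[of y] zero_le_power2[of z] by linarith
    then have "A = Sigma ?I (\<lambda>i. odd_even_even (m - i\<^sup>2))"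
      unfolding A_def odd_even_even_def by (fastforce simp: abs_le_iff algebra_simps)
    also have "card \<dots> = (\<Sum>i \<in> ?I. card (odd_even_even (m - i\<^sup>2)))"
      by (rule card_SigmaI, rule finite_subset[of _ "{-m..m}"]) (auto simp: finite_odd_even_even)
    finally show ?thesis .
  qed
  ultimately show ?thesis unfolding r4_def by simp
qed

text \<open>Summed over m - i^2 with \<open>i\<close> even, both sides give twice the divisor sum of
  \<open>m\<close>. By induction the terms with i \<noteq> 0 agree, hence so do those with i =
  0.\<close>

theorem card_odd_even_even:
  assumes "m mod 4 = 1"
  shows "int (card (odd_even_even m)) = 2 * int (card (reduced_forms m))"
  using assms
proof (induction "nat m" arbitrary: m rule: less_induct)
  case less
  show ?case
  proof (cases "0 < m")
    case True
    let ?I = "{i \<in> {-m..m}. even i}"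
    have fI: "finite ?I" "0 \<in> ?I" using True by (auto intro: finite_subset[of _ "{-m..m}"])
    interpret odd_det m by standard (use less True in auto)
    have "odd m" using less.prems by presburger
    have sums: "(\<Sum>i \<in> ?I. int (card (odd_even_even (m - i\<^sup>2)))) = (\<Sum>i \<in> ?I. 2 * int (card (reduced_forms (m - i\<^sup>2))))"
      using card_four_squares_split[OF less.prems] r4_odd[OF True \<open>odd m\<close>] sum_card_reduced_forms
      by (simp flip: sum_distrib_left)
    have "int (card (odd_even_even (m - i\<^sup>2))) = 2 * int (card (reduced_forms (m - i\<^sup>2)))" if "i \<in> ?I - {0}" for i
    proof (rule less.hyps)
      have "0 < i\<^sup>2" using that by simp
      then show "nat (m - i\<^sup>2) < nat m" using True by linarith
      have "i\<^sup>2 mod 4 = 0" using that by (simp add: square_mod_4)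
      then show "(m - i\<^sup>2) mod 4 = 1" using less.prems by presburger
    qed
    then have "(\<Sum>i \<in> ?I - {0}. int (card (odd_even_even (m - i\<^sup>2))))
        = (\<Sum>i \<in> ?I - {0}. 2 * int (card (reduced_forms (m - i\<^sup>2))))"
      by (intro sum.cong refl)
    then show ?thesis using sums fI by (simp only: sum.remove[OF fI]) simp
  next
    case False
    then show ?thesis by (simp add: odd_even_even_nonpos reduced_forms_nonpos)
  qed
qed

corollary three_squares:
  assumes "m mod 4 = 1" "0 < m"
  obtains x y z :: int where "odd x" "m = x\<^sup>2 + (2 * y)\<^sup>2 + (2 * z)\<^sup>2"
proof -
  have "odd m" using assms(1) by presburger
  then have "(1, m, 0) \<in> reduced_forms m" using assms(2) by (simp add: reduced_forms_def)
  then have "0 < card (reduced_forms m)" using finite_reduced_forms by (auto simp: card_gt_0_iff)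
  then have "odd_even_even m \<noteq> {}" using card_odd_even_even[OF assms(1)] by auto
  then obtain x y z where "odd x" "even y" "even z" "x\<^sup>2 + y\<^sup>2 + z\<^sup>2 = m"
    by (auto simp: odd_even_even_def)
  then show ?thesis using that by (metis dvdE)
qed

section \<open>Representations of given parity\<close>

lemma chi_sum_mod_3: "0 \<le> k \<Longrightarrow> (\<Sum>j \<in> {0<..<4 * k + 3}. chi j) = 1"
proof (induction k rule: int_ge_induct)
  case base
  have "{0<..<3 :: int} = {1, 2}" by auto
  then show ?case by (simp add: chi_def)
next
  case (step k)
  have "{0<..<4 * (k + 1) + 3} = {0<..<4 * k + 3} \<union> {4 * k + 3, 4 * k + 4, 4 * k + 5, 4 * k + 6}"
    using step by auto
  moreover have "(\<Sum>j \<in> {0<..<4 * k + 3} \<union> {4 * k + 3, 4 * k + 4, 4 * k + 5, 4 * k + 6}. chi j)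
      = (\<Sum>j \<in> {0<..<4 * k + 3}. chi j) + (\<Sum>j \<in> {4 * k + 3, 4 * k + 4, 4 * k + 5, 4 * k + 6}. chi j)"
    by (rule sum.union_disjoint) auto
  moreover have "chi (4 * k + 3) = -1" "chi (4 * k + 4) = 0" "chi (4 * k + 5) = 1" "chi (4 * k + 6) = 0"
    unfolding chi_def by presburger+
  ultimately show ?case using step by simp
qed

text \<open>For odd \<open>m\<close> every \<open>X\<close> is odd, and e + X = (e - X) + 2 * X, so
  replacing \<open>X\<close> by - X negates the summand.\<close>

lemma liouville_chi_left:
  assumes "odd m"
  shows "(\<Sum>(X, d, e) \<in> liouville_set m. chi (e - X)) = 0"
proof -
  have "odd X" if "(X, d, e) \<in> liouville_set m" for X d e
  proof -
    have "X\<^sup>2 = m - 2 * (2 * d * e)" using that by (simp add: liouville_set_def)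
    then have "odd (X\<^sup>2)" using assms by presburger
    then show ?thesis by simp
  qed
  then have "(\<Sum>(X, d, e) \<in> liouville_set m. chi (e - X))
      = (\<Sum>(X, d, e) \<in> liouville_set m. if odd X then chi (e - X) else 0)"
    by (intro sum.cong) auto
  also have "\<dots> = 0"
  proof (rule sum_liouville_odd)
    fix X d e :: int
    have "chi (e + X) = sg X * chi (e - X)" using chi_add_double[of "e - X" X] by (simp add: add.commute)
    then show "(if odd (- X) then chi (e - - X) else 0) = - (if odd X then chi (e - X) else 0)"
      by (simp add: sg_def)
  qed
  finally show ?thesis .
qed

text \<open>Liouville's identity for F x w z = chi x, whose left side vanishes. For m = s^2 the
  corrections are 2 * 1, from \<open>chi_sum_mod_3\<close>, and minus s - 1 copies of chi s =
  -1.\<close>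

lemma liouville_chi_right:
  assumes "odd m"
  shows "(\<And>s. m \<noteq> s\<^sup>2) \<Longrightarrow> (\<Sum>(X, d, e) \<in> liouville_set m. chi (d + e)) = 0"
    and "m = s\<^sup>2 \<Longrightarrow> 0 < s \<Longrightarrow> s mod 4 = 3 \<Longrightarrow> (\<Sum>(X, d, e) \<in> liouville_set m. chi (d + e)) = - (s + 1)"
proof -
  define F where "F x w z = chi x" for x w z :: int
  have F: "F (- x) w z = - F x w z" "F x (- w) (- z) = F x w z" for x w z by (simp_all add: F_def)
  {
    assume "\<And>s. m \<noteq> s\<^sup>2"
    then show "(\<Sum>(X, d, e) \<in> liouville_set m. chi (d + e)) = 0"
      using liouville_nonsquare[of F m] F liouville_chi_left[OF assms] by (simp add: F_def)
  }
  {
    assume s: "m = s\<^sup>2" "0 < s" "s mod 4 = 3"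
    define k where "k = s div 4"
    have k: "s = 4 * k + 3" "0 \<le> k" using s mult_div_mod_eq[of 4 s] by (auto simp: k_def)
    have "chi s = -1" using s(3) by (simp add: chi_def)
    then have "0 = (\<Sum>(X, d, e) \<in> liouville_set m. chi (d + e)) + 2 * 1 + (s - 1)"
      using liouville_square[of F s] F s liouville_chi_left[OF assms] chi_sum_mod_3[OF k(2)]
      unfolding k(1)[symmetric] by (simp add: F_def)
    then show "(\<Sum>(X, d, e) \<in> liouville_set m. chi (d + e)) = - (s + 1)" by simp
  }
qed

text \<open>The summand is zero unless exactly one of \<open>d\<close>, \<open>e\<close> is even,
  and exchanging them matches the two cases.\<close>

lemma liouville_chi_halves:
  "(\<Sum>(X, d, e) \<in> liouville_set m. chi (d + e)) = 2 * (\<Sum>(X, d, e) \<in> liouville_set m. if even e then chi (d + e) else 0)"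
proof -
  have "(\<Sum>(X, d, e) \<in> liouville_set m. chi (d + e))
      = (\<Sum>(X, d, e) \<in> liouville_set m. if even e then chi (d + e) else 0)
        + (\<Sum>(X, d, e) \<in> liouville_set m. if even d then chi (d + e) else 0)"
    unfolding sum.distrib[symmetric] by (rule sum.cong) (auto simp: chi_even)
  also have "(\<Sum>(X, d, e) \<in> liouville_set m. if even d then chi (d + e) else 0)
      = (\<Sum>(X, d, e) \<in> liouville_set m. if even e then chi (d + e) else 0)"
    unfolding sum_liouville_swap[of "\<lambda>X d e. if even d then chi (d + e) else 0"]
    by (rule sum.cong) (auto simp: add.commute)
  finally show ?thesis by simp
qed

section \<open>Signed count of representations by x^2 + 8 p^2 + 8 q^2\<close>

lemma sum_sg_two_squares: "(\<Sum>(p, q) \<in> {(p, q). p\<^sup>2 + q\<^sup>2 = N}. sg (p + q)) = sg N * r2 N"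
proof -
  have "(\<Sum>(p, q) \<in> {(p, q). p\<^sup>2 + q\<^sup>2 = N}. sg (p + q)) = (\<Sum>t \<in> {(p, q). p\<^sup>2 + q\<^sup>2 = N}. sg N)"
    by (rule sum.cong) (auto simp: sg_def)
  then show ?thesis by (simp add: r2_def)
qed

text \<open>For fixed \<open>x\<close> with m - x^2 = 8 * N the inner sum is sg N * r2 N. In the
  two-square formula only odd \<open>d\<close> count, and for these sg N * chi d = chi (d + 2 * e)
  when N = d * e; so (x, d, 2 * e) runs through the elements of \<open>liouville_set m\<close> with
  even last entry. The last term comes from N = 0.\<close>

lemma signed_representations:
  assumes "m mod 8 = 1"
  shows "(\<Sum>(x, p, q) \<in> {(x, p, q). x\<^sup>2 + 8 * p\<^sup>2 + 8 * q\<^sup>2 = m}. sg (p + q))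
    = 2 * (\<Sum>(X, d, e) \<in> liouville_set m. chi (d + e)) + int (card {x. x\<^sup>2 = m})"
proof -
  let ?I = "{x \<in> {-m..m}. 8 dvd m - x\<^sup>2}"
  have fI: "finite ?I" by (rule finite_subset[of _ "{-m..m}"]) auto
  have bnd: "x \<in> ?I" if "x\<^sup>2 + 8 * N = m" "0 \<le> N" for x N
  proof -
    have "\<bar>x\<bar> \<le> m" using that abs_le_power2[of x] by linarith
    moreover have "m - x\<^sup>2 = 8 * N" using that by simp
    ultimately show ?thesis by (auto simp: abs_le_iff)
  qed
  have "{(x, p, q). x\<^sup>2 + 8 * p\<^sup>2 + 8 * q\<^sup>2 = m} = Sigma ?I (\<lambda>x. {(p, q). p\<^sup>2 + q\<^sup>2 = (m - x\<^sup>2) div 8})"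
    (is "?W = ?S")
  proof (intro equalityI subsetI)
    fix t assume t: "t \<in> ?W"
    obtain x p q where tt: "t = (x, p, q)" by (cases t)
    have "x\<^sup>2 + 8 * (p\<^sup>2 + q\<^sup>2) = m" using t tt by simp
    moreover from this have "(m - x\<^sup>2) div 8 = p\<^sup>2 + q\<^sup>2" by auto
    ultimately show "t \<in> ?S" using bnd[of x "p\<^sup>2 + q\<^sup>2"] tt by simp
  next
    fix t assume t: "t \<in> ?S"
    obtain x p q where tt: "t = (x, p, q)" by (cases t)
    have "8 dvd m - x\<^sup>2" "p\<^sup>2 + q\<^sup>2 = (m - x\<^sup>2) div 8" using t tt by auto
    then have "8 * (p\<^sup>2 + q\<^sup>2) = m - x\<^sup>2" by simp
    then show "t \<in> ?W" using tt by simp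
  qed
  then have "(\<Sum>(x, p, q) \<in> ?W. sg (p + q))
      = (\<Sum>x \<in> ?I. \<Sum>(p, q) \<in> {(p, q). p\<^sup>2 + q\<^sup>2 = (m - x\<^sup>2) div 8}. sg (p + q))"
    using fI by (simp add: sum.Sigma)
  also have "\<dots> = (\<Sum>x \<in> ?I. 4 * (\<Sum>(d, e) \<in> divisor_pairs ((m - x\<^sup>2) div 8). chi (d + 2 * e))
      + (if x\<^sup>2 = m then 1 else 0))"
  proof (rule sum.cong[OF refl])
    fix x assume x: "x \<in> ?I"
    define N where "N = (m - x\<^sup>2) div 8"
    have N: "m - x\<^sup>2 = 8 * N" using x by (simp add: N_def)
    have "sg N * r2 N = 4 * (\<Sum>(d, e) \<in> divisor_pairs N. chi (d + 2 * e)) + (if N = 0 then 1 else 0)"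
    proof (cases "0 < N")
      case True
      have "sg N * quarter_r2 N = (\<Sum>(d, e) \<in> divisor_pairs N. chi (d + 2 * e))"
        unfolding quarter_r2_def sum_distrib_left
      proof (rule sum.cong[OF refl])
        fix t assume t: "t \<in> divisor_pairs N"
        obtain d e where tt: "t = (d, e)" by (cases t)
        have "sg N * chi d = sg e * chi d"
          using t tt chi_even[of d] by (auto simp: divisor_pairs_def sg_def)
        then show "sg N * (case t of (d, e) \<Rightarrow> chi d) = (case t of (d, e) \<Rightarrow> chi (d + 2 * e))"
          by (simp add: tt chi_add_double)
      qed
      then show ?thesis using True r2_formula[OF True] by simp
    next
      case False
      then show ?thesis using r2_neg[of N] r2_0
        by (cases "N = 0") (auto simp: divisor_pairs_nonpos sg_def)
    qed
    moreover have "N = 0 \<longleftrightarrow> x\<^sup>2 = m" using N by auto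
    ultimately show "(\<Sum>(p, q) \<in> {(p, q). p\<^sup>2 + q\<^sup>2 = (m - x\<^sup>2) div 8}. sg (p + q))
        = 4 * (\<Sum>(d, e) \<in> divisor_pairs ((m - x\<^sup>2) div 8). chi (d + 2 * e)) + (if x\<^sup>2 = m then 1 else 0)"
      unfolding sum_sg_two_squares N_def[symmetric] by simp
  qed
  also have "\<dots> = 4 * (\<Sum>x \<in> ?I. \<Sum>(d, e) \<in> divisor_pairs ((m - x\<^sup>2) div 8). chi (d + 2 * e))
      + (\<Sum>x \<in> ?I. if x\<^sup>2 = m then 1 else 0)"
    unfolding sum_distrib_left sum.distrib by (rule refl)
  also have "(\<Sum>x \<in> ?I. if x\<^sup>2 = m then 1 else 0) = int (card {x. x\<^sup>2 = m})"
  proof -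
    have "{x \<in> ?I. x\<^sup>2 = m} = {x. x\<^sup>2 = m}" using bnd[of _ 0] by auto
    moreover have "(\<Sum>x \<in> ?I. if x\<^sup>2 = m then 1 else 0) = int (card {x \<in> ?I. x\<^sup>2 = m})"
      unfolding sum.inter_filter[OF fI, symmetric] by simp
    ultimately show ?thesis by simp
  qed
  also have "(\<Sum>x \<in> ?I. \<Sum>(d, e) \<in> divisor_pairs ((m - x\<^sup>2) div 8). chi (d + 2 * e))
      = (\<Sum>(x, d, e) \<in> Sigma ?I (\<lambda>x. divisor_pairs ((m - x\<^sup>2) div 8)). chi (d + 2 * e))"
    by (rule sum.Sigma) (use fI finite_divisor_pairs in auto)
  also have "\<dots> = (\<Sum>(X, d, e) \<in> {(X, d, e) \<in> liouville_set m. even e}. chi (d + e))"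
  proof (rule sum.reindex_bij_witness[where j = "\<lambda>(x, d, e). (x, d, 2 * e)" and i = "\<lambda>(X, d, e). (X, d, e div 2)"],
      goal_cases)
    case (2 t)
    obtain x d e where tt: "t = (x, d, e)" by (cases t)
    have "8 dvd m - x\<^sup>2" "0 < d" "0 < e" "d * e = (m - x\<^sup>2) div 8"
      using 2 tt by (auto simp: divisor_pairs_def)
    then have "8 * (d * e) = m - x\<^sup>2" "0 < d" "0 < e" by simp_all
    then show ?case by (simp add: tt liouville_set_def)
  next
    case (4 t)
    obtain X d e' where tt: "t = (X, d, e')" by (cases t)
    obtain e where e: "e' = 2 * e" using 4 tt by auto
    have L: "0 < d" "0 < e" "X\<^sup>2 + 8 * (d * e) = m" using 4 tt e by (auto simp: liouville_set_def)
    then have "X \<in> ?I" using bnd[of X "d * e"] by simp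
    moreover have "(m - X\<^sup>2) div 8 = d * e" using L by auto
    ultimately show ?case using L by (simp add: tt e divisor_pairs_def)
  qed auto
  also have "\<dots> = (\<Sum>(X, d, e) \<in> liouville_set m. if even e then chi (d + e) else 0)"
  proof -
    have eq: "{(X, d, e) \<in> liouville_set m. even e} = {t \<in> liouville_set m. even (snd (snd t))}" by auto
    show ?thesis unfolding eq sum.inter_filter[OF finite_liouville_set] by (rule sum.cong) auto
  qed
  finally show ?thesis using liouville_chi_halves[of m] by simp
qed

theorem exists_odd_representation:
  assumes m: "m mod 8 = 1" "0 < m"
    and "(\<forall>s. m \<noteq> s\<^sup>2) \<or> (\<exists>s. m = s\<^sup>2 \<and> 0 < s \<and> s mod 4 = 3)"
  shows "\<exists>x p q :: int. m = x\<^sup>2 + 8 * (p\<^sup>2 + q\<^sup>2) \<and> odd (p + q)"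
proof -
  let ?W = "{(x, p, q). x\<^sup>2 + 8 * p\<^sup>2 + 8 * q\<^sup>2 = m}"
  have "odd m" using m(1) by presburger
  have nonpos: "(\<Sum>(x, p, q) \<in> ?W. sg (p + q)) \<le> 0"
  proof (cases "\<forall>s. m \<noteq> s\<^sup>2")
    case True
    then have "{x. x\<^sup>2 = m} = {}" by auto
    then show ?thesis using signed_representations[OF m(1)] liouville_chi_right(1)[OF \<open>odd m\<close>] True by simp
  next
    case False
    then obtain s where s: "m = s\<^sup>2" "0 < s" "s mod 4 = 3" using assms(3) by auto
    have "{x. x\<^sup>2 = m} = {s, - s}" using s by (auto simp: power2_eq_iff)
    then show ?thesis using signed_representations[OF m(1)] liouville_chi_right(2)[OF \<open>odd m\<close> s] s(2) by simp
  qed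
  have "m mod 4 = 1" using m(1) by presburger
  then obtain x y z where xyz: "odd x" "m = x\<^sup>2 + (2 * y)\<^sup>2 + (2 * z)\<^sup>2" using m(2) three_squares by blast
  \<comment> \<open>As m - x^2 is divisible by 8, \<open>y\<close> and \<open>z\<close> have equal
    parity. With y = p + q and z = p - q, 4 * (y^2 + z^2) becomes 8 * (p^2 + q^2).\<close>
  have "4 * (y\<^sup>2 + z\<^sup>2) = m - x\<^sup>2" using xyz by simp
  moreover have "8 dvd m - x\<^sup>2" using square_mod_8[OF xyz(1)] m(1) by (simp add: mod_eq_dvd_iff[symmetric])
  then obtain k where "m - x\<^sup>2 = 8 * k" by blast
  ultimately have "y\<^sup>2 + z\<^sup>2 = 2 * k" by simp
  then have "even (y\<^sup>2 + z\<^sup>2)" by simp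
  then have "even (y + z)" "even (y - z)" by auto
  then obtain p q where "y + z = 2 * p" "y - z = 2 * q" by (meson evenE)
  then have yz: "y = p + q" "z = p - q" by linarith+
  have ne: "(x, p, q) \<in> ?W" using xyz(2) unfolding yz by (simp add: power2_eq_square algebra_simps)
  have "x \<in> {-m..m} \<and> p \<in> {-m..m} \<and> q \<in> {-m..m}" if "x\<^sup>2 + 8 * p\<^sup>2 + 8 * q\<^sup>2 = m" for x p q
    unfolding atLeastAtMost_iff
    using that abs_le_power2[of x] abs_le_power2[of p] abs_le_power2[of q] by (intro conjI; linarith)
  then have "?W \<subseteq> {-m..m} \<times> {-m..m} \<times> {-m..m}" by auto
  then have fin: "finite ?W" by (rule finite_subset) simp
  have "\<exists>x p q. x\<^sup>2 + 8 * p\<^sup>2 + 8 * q\<^sup>2 = m \<and> odd (p + q)"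
  proof (rule ccontr)
    \<comment> \<open>If p + q were always even, the signed sum would be the number of
      representations, which is positive, against \<open>nonpos\<close>.\<close>
    assume c: "\<not> (\<exists>x p q. x\<^sup>2 + 8 * p\<^sup>2 + 8 * q\<^sup>2 = m \<and> odd (p + q))"
    have "(\<Sum>(x, p, q) \<in> ?W. sg (p + q)) = (\<Sum>t \<in> ?W. 1)"
    proof (rule sum.cong[OF refl])
      fix t assume t: "t \<in> ?W"
      obtain x p q where tt: "t = (x, p, q)" by (cases t)
      have "even (p + q)" using c t tt by blast
      then show "(case t of (x, p, q) \<Rightarrow> sg (p + q)) = 1" by (simp add: tt sg_def)
    qed
    moreover have "card ?W \<noteq> 0" using ne fin by (metis card_0_eq empty_iff)
    ultimately show False using nonpos by simp
  qed
  then obtain x p q where "x\<^sup>2 + 8 * p\<^sup>2 + 8 * q\<^sup>2 = m" "odd (p + q)" by blast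
  then show ?thesis by (intro exI[of _ x] exI[of _ p] exI[of _ q]) auto
qed

section \<open>Squares without prime factors 4k + 3\<close>

text \<open>Raising x^2 = - y^2 modulo \<open>l\<close> to the odd power (l - 1) / 2 would give 1 =
  -1 by Fermat's theorem if neither were divisible by \<open>l\<close>.\<close>

lemma prime_3_mod_4_dvd_sum_squares:
  fixes x y :: int and l :: nat
  assumes l: "prime l" "l mod 4 = 3" and dvd: "int l dvd x\<^sup>2 + y\<^sup>2"
  shows "int l dvd x"
proof (rule ccontr)
  assume nx: "\<not> int l dvd x"
  have pl: "prime (int l)" using l by simp
  have ny: "\<not> int l dvd y"
  proof
    assume "int l dvd y"
    then have "int l dvd y\<^sup>2" by (simp add: power2_eq_square)
    then have "int l dvd x\<^sup>2" using dvd by (simp add: dvd_add_left_iff)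
    then show False using nx pl by (simp add: prime_dvd_power_iff)
  qed
  have fermat: "[a ^ (l - 1) = 1] (mod int l)" if "\<not> int l dvd a" for a :: int
  proof -
    have "\<not> l dvd nat \<bar>a\<bar>" using that by (simp flip: int_dvd_int_iff)
    then have "[nat \<bar>a\<bar> ^ (l - 1) = 1] (mod l)" using fermat_theorem l(1) by blast
    then have "[int (nat \<bar>a\<bar> ^ (l - 1)) = int 1] (mod int l)" by (simp only: cong_int_iff)
    moreover have "even (l - 1)" using l(2) by presburger
    ultimately show ?thesis by (simp add: power_even_abs)
  qed
  define k where "k = (l - 1) div 2"
  have k: "l - 1 = 2 * k" "odd k" using l(2) unfolding k_def by presburger+
  have "[x\<^sup>2 = - (y\<^sup>2)] (mod int l)" using dvd by (simp add: cong_iff_dvd_diff)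
  then have "[(x\<^sup>2) ^ k = (- (y\<^sup>2)) ^ k] (mod int l)" by (rule cong_pow)
  then have "[x ^ (l - 1) = - (y ^ (l - 1))] (mod int l)"
    unfolding k(1) power_mult using k(2) by simp
  then have "[1 = - 1] (mod int l)"
    using fermat[OF nx] fermat[OF ny] by (meson cong_minus_minus_iff cong_sym cong_trans)
  then have "int l dvd 2" by (simp add: cong_iff_dvd_diff)
  then have "l \<le> 2" using zdvd_imp_le[of "int l" 2] by simp
  then show False using l by (auto simp: numeral_2_eq_2 le_Suc_eq)
qed

lemma mod_4_eq_1_of_primes:
  fixes n :: nat
  assumes "odd n" "\<And>p. prime p \<Longrightarrow> p dvd n \<Longrightarrow> p mod 4 \<noteq> 3"
  shows "n mod 4 = 1"
  using assms
proof (induction n rule: less_induct)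
  case (less n)
  show ?case
  proof (cases "n = 1")
    case False
    then obtain p where p: "prime p" "p dvd n" using prime_factor_nat by blast
    then obtain k where k: "n = p * k" by blast
    have "odd p" "odd k" using less.prems(1) k by auto
    moreover have "p mod 4 \<noteq> 3" using less.prems(2) p by blast
    ultimately have "p mod 4 = 1" by presburger
    moreover have "k mod 4 = 1"
    proof (rule less.IH)
      show "k < n" using k prime_gt_1_nat[OF p(1)] less.prems(1) by (cases "k = 0") auto
      show "odd k" by fact
      show "q mod 4 \<noteq> 3" if "prime q" "q dvd k" for q using less.prems(2) that k by simp
    qed
    ultimately have "p mod 4 * (k mod 4) mod 4 = 1" by simp
    then show ?thesis by (simp add: k mod_mult_eq)
  qed simp
qed

text \<open>A prime p = 3 modulo 4 dividing \<open>A\<close> divides both \<open>x\<close> and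
  \<open>y\<close>, so p^2 divides A * B and, \<open>p\<close> being prime to \<open>B\<close>,
  already \<open>A\<close>. Dividing out p^2, which is 1 modulo 4, removes such primes one square at
  a time.\<close>

lemma factor_of_sum_squares_mod_4:
  fixes A B :: nat
  assumes "int (A * B) = x\<^sup>2 + y\<^sup>2" "odd A" "\<And>p. prime p \<Longrightarrow> p mod 4 = 3 \<Longrightarrow> p dvd A \<Longrightarrow> p dvd B \<Longrightarrow> False"
  shows "A mod 4 = 1"
  using assms
proof (induction A arbitrary: x y rule: less_induct)
  case (less A)
  show ?case
  proof (cases "\<exists>p. prime p \<and> p dvd A \<and> p mod 4 = 3")
    case False
    then show ?thesis using mod_4_eq_1_of_primes[OF less.prems(2)] by blast
  next
    case True
    then obtain p where p: "prime p" "p dvd A" "p mod 4 = 3" by blast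
    have "int p dvd int (A * B)" using p(2) by (simp only: int_dvd_int_iff dvd_mult2)
    then have xy: "int p dvd x\<^sup>2 + y\<^sup>2" "int p dvd y\<^sup>2 + x\<^sup>2" unfolding less.prems(1) by (simp_all add: add.commute)
    have "int p dvd x" "int p dvd y"
      using prime_3_mod_4_dvd_sum_squares[OF p(1,3)] xy by blast+
    then obtain u v where uv: "x = int p * u" "y = int p * v" by (auto elim!: dvdE)
    then have sq: "int (A * B) = (int p)\<^sup>2 * (u\<^sup>2 + v\<^sup>2)"
      using less.prems(1) by (simp add: power_mult_distrib algebra_simps)
    then have "int (p\<^sup>2) dvd int (A * B)" by simp
    then have "p\<^sup>2 dvd A * B" by (simp only: int_dvd_int_iff)
    moreover have "\<not> p dvd B" using less.prems(3)[OF p(1,3,2)] by blast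
    then have "coprime p B" by (rule prime_imp_coprime[OF p(1)])
    then have "coprime (p\<^sup>2) B" by simp
    ultimately have "p\<^sup>2 dvd A" by (simp add: coprime_dvd_mult_left_iff)
    then obtain C where C: "A = p\<^sup>2 * C" by blast
    have pos: "0 < p" "1 < p" using prime_gt_1_nat[OF p(1)] by simp_all
    have "C mod 4 = 1"
    proof (rule less.IH)
      have "C \<noteq> 0" using less.prems(2) C by (intro notI) simp
      moreover have "1 < p\<^sup>2" using pos one_less_power[of p 2] by simp
      ultimately show "C < A" using C by simp
      show "odd C" using less.prems(2) C by simp
      have "int (p\<^sup>2) * int (C * B) = int (p\<^sup>2) * (u\<^sup>2 + v\<^sup>2)" using sq C by (simp add: mult.assoc)
      then show "int (C * B) = u\<^sup>2 + v\<^sup>2" using pos by simp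
      show False if "prime q" "q mod 4 = 3" "q dvd C" "q dvd B" for q
        using less.prems(3)[of q] that C by simp
    qed
    moreover have "p\<^sup>2 mod 4 = 1"
    proof -
      have "(p mod 4) * (p mod 4) mod 4 = 1" using p(3) by simp
      then show ?thesis by (simp only: power2_eq_square mod_mult_eq)
    qed
    ultimately have "(p\<^sup>2 mod 4) * (C mod 4) mod 4 = 1" by simp
    then show ?thesis unfolding C by (simp only: mod_mult_eq)
  qed
qed

lemma not_odd_representation:
  fixes s :: nat and x p q :: int
  assumes primes: "\<And>l. prime l \<Longrightarrow> l dvd s \<Longrightarrow> l mod 4 \<noteq> 3" and s: "odd s"
    and eq: "(int s)\<^sup>2 = x\<^sup>2 + 8 * (p\<^sup>2 + q\<^sup>2)" and pq: "odd (p + q)"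
  shows False
proof -
  have odd_N: "odd (p\<^sup>2 + q\<^sup>2)" using pq by simp
  then have N: "0 < p\<^sup>2 + q\<^sup>2" by (metis even_zero not_sum_power2_lt_zero linorder_neqE_linordered_idom)
  have "\<bar>x\<bar>\<^sup>2 < (int s)\<^sup>2" using eq N by simp
  then have xs: "\<bar>x\<bar> < int s" by (rule power2_less_imp_less) simp
  have "odd (x\<^sup>2)" using eq s by (metis even_add even_mult_iff even_numeral even_of_nat even_power pos2)
  then have ox: "odd x" by simp
  \<comment> \<open>Here \<open>y\<close> will be x or - x: since \<open>s\<close> and
    \<open>x\<close> are odd, 4 divides s - x or s + x.\<close>
  have main: False if x: "\<bar>y\<bar> < int s" "odd y" "y\<^sup>2 = x\<^sup>2" "4 dvd int s - y" for y
  proof -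
    obtain A where A: "int s - y = 4 * A" using x(4) by blast
    define B where "B = int s - 2 * A"
    have B: "int s + y = 2 * B" "2 * A + B = int s" using A unfolding B_def by simp_all
    have "(int s - y) * (int s + y) = 8 * (p\<^sup>2 + q\<^sup>2)" using eq x(3) by (simp add: power2_eq_square algebra_simps)
    then have AB: "A * B = p\<^sup>2 + q\<^sup>2" unfolding A B by simp
    have pos: "0 < A" "0 < B" using A B x(1) by linarith+
    define a b where "a = nat A" and "b = nat B"
    have ab: "A = int a" "B = int b" using pos by (simp_all add: a_def b_def)
    have odd: "odd a" "odd b" using odd_N unfolding AB[symmetric] ab by simp_all
    have sab: "2 * a + b = s" using B(2) unfolding ab by linarith
    \<comment> \<open>A common prime of \<open>a\<close> and \<open>b\<close> divides 2 * a + b =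
      s.\<close>
    have dv: False if l: "prime l" "l mod 4 = 3" "l dvd a" "l dvd b" for l
      using primes[of l] l sab by (metis dvd_add dvd_mult)
    have "a mod 4 = 1"
      by (rule factor_of_sum_squares_mod_4[of a b p q]) (use AB ab odd dv in auto)
    moreover have "b mod 4 = 1"
      by (rule factor_of_sum_squares_mod_4[of b a p q]) (use AB ab odd dv in \<open>auto simp: mult.commute\<close>)
    ultimately have "a = 4 * (a div 4) + 1" "b = 4 * (b div 4) + 1"
      using mult_div_mod_eq[of 4 a] mult_div_mod_eq[of 4 b] by simp_all
    then obtain i j where "a = 4 * i + 1" "b = 4 * j + 1" by blast
    then have "s = 4 * (2 * i + j) + 3" using sab by simp
    then have "s mod 4 = 3" by presburger
    moreover have "s mod 4 = 1" using mod_4_eq_1_of_primes[OF s primes] by blast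
    ultimately show False by simp
  qed
  have "4 dvd u - v \<or> 4 dvd u - (- v)" if "odd u" "odd v" for u v :: int using that by presburger
  then have "4 dvd int s - x \<or> 4 dvd int s - (- x)" using ox s by simp
  then show False using main[of x] main[of "- x"] xs ox by auto
qed

section \<open>Completing the squares\<close>

lemma triangular_iff:
  fixes n :: nat
  shows "(\<exists>x y z :: int. int n = x * (x - 1) div 2 + y * (y - 1) div 2 + 8 * (z * (z - 1) div 2)) \<longleftrightarrow>
    (\<exists>a b c :: int. odd a \<and> odd c \<and> 4 * int n + 5 = a\<^sup>2 + 4 * b\<^sup>2 + 4 * c\<^sup>2)" (is "?L \<longleftrightarrow> ?R")
proof -
  define T where "T t = t * (t - 1) div 2" for t :: int
  have tri: "8 * T t = (2 * t - 1)\<^sup>2 - 1" for t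
  proof -
    have "even (t * (t - 1))" by simp
    then have "2 * T t = t * (t - 1)" unfolding T_def by simp
    then show ?thesis by (simp add: power2_eq_square algebra_simps)
  qed
  show ?thesis unfolding T_def[symmetric]
  proof
    assume "\<exists>x y z. int n = T x + T y + 8 * T z"
    then obtain x y z where n: "int n = T x + T y + 8 * T z" by blast
    have "8 * int n = ((2 * x - 1)\<^sup>2 - 1) + ((2 * y - 1)\<^sup>2 - 1) + 8 * ((2 * z - 1)\<^sup>2 - 1)"
      unfolding n tri[symmetric] by simp
    \<comment> \<open>The odd squares of 2 * x - 1 and 2 * y - 1 combine to twice the squares of
      their half sum and half difference. Exactly one of these, x + y - 1 and x - y, is odd and
      becomes \<open>a\<close>; the other becomes 2 * b.\<close>
    then have e: "4 * int n + 5 = (x + y - 1)\<^sup>2 + (x - y)\<^sup>2 + 4 * (2 * z - 1)\<^sup>2"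
      by (simp add: power2_eq_square algebra_simps)
    have oz: "odd (2 * z - 1)" by simp
    show ?R
    proof (cases "even (x - y)")
      case True
      then obtain b where "x - y = 2 * b" by blast
      moreover have "odd (x + y - 1)" using True by presburger
      ultimately show ?thesis using e oz by (intro exI[of _ "x + y - 1"] exI[of _ b] exI[of _ "2 * z - 1"]) simp
    next
      case False
      then have "even (x + y - 1)" by presburger
      then obtain b where "x + y - 1 = 2 * b" by blast
      then show ?thesis using e oz False by (intro exI[of _ "x - y"] exI[of _ b] exI[of _ "2 * z - 1"]) simp
    qed
  next
    assume ?R
    then obtain a b c where o: "odd a" "odd c" and e: "4 * int n + 5 = a\<^sup>2 + 4 * b\<^sup>2 + 4 * c\<^sup>2" by blast
    have "odd (a + 2 * b)" "odd (a - 2 * b)" using o by simp_all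
    then obtain x y z where x: "a + 2 * b = 2 * x + 1" "a - 2 * b = 2 * y + 1" "c = 2 * z + 1"
      using o by (meson oddE)
    have "8 * int n = ((2 * (x + 1) - 1)\<^sup>2 - 1) + ((2 * (y + 1) - 1)\<^sup>2 - 1) + 8 * ((2 * (z + 1) - 1)\<^sup>2 - 1)"
    proof -
      have x': "2 * (x + 1) - 1 = a + 2 * b" "2 * (y + 1) - 1 = a - 2 * b" "2 * (z + 1) - 1 = c" using x by simp_all
      show ?thesis unfolding x' using e by (simp add: power2_eq_square algebra_simps)
    qed
    also have "\<dots> = 8 * (T (x + 1) + T (y + 1) + 8 * T (z + 1))"
      unfolding tri[symmetric] by simp
    finally have "int n = T (x + 1) + T (y + 1) + 8 * T (z + 1)" by simp
    then show "\<exists>x y z. int n = T x + T y + 8 * T z" by blast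
  qed
qed

section \<open>Both directions of the criterion\<close>

theorem theorem2p2:
  fixes n :: nat
  assumes "n > 0"
  shows "(\<exists>x y z :: int. int n = x * (x - 1) div 2 + y * (y - 1) div 2 + 8 * (z * (z - 1) div 2)) \<longleftrightarrow>
         (\<not> (\<exists>m :: nat. 4 * n + 5 = m ^ 2) \<or>
          (\<exists>p k :: nat. prime p \<and> p dvd 4 * n + 5 \<and> p = 4 * k + 3))"
  unfolding triangular_iff
proof
  assume "\<exists>a b c :: int. odd a \<and> odd c \<and> 4 * int n + 5 = a\<^sup>2 + 4 * b\<^sup>2 + 4 * c\<^sup>2"
  then obtain a b c :: int where abc: "odd a" "odd c" "4 * int n + 5 = a\<^sup>2 + 4 * b\<^sup>2 + 4 * c\<^sup>2" by blast
  show "\<not> (\<exists>m. 4 * n + 5 = m\<^sup>2) \<or> (\<exists>p k. prime p \<and> p dvd 4 * n + 5 \<and> p = 4 * k + 3)"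
  proof (rule ccontr)
    assume "\<not> ?thesis"
    then obtain s where s: "4 * n + 5 = s\<^sup>2" and np: "\<And>p k. prime p \<Longrightarrow> p dvd 4 * n + 5 \<Longrightarrow> p \<noteq> 4 * k + 3" by blast
    have "odd (s\<^sup>2)" unfolding s[symmetric] by simp
    then have os: "odd s" by simp
    have sq: "(int s)\<^sup>2 = a\<^sup>2 + 4 * (b\<^sup>2 + c\<^sup>2)"
      using abc(3) arg_cong[OF s, of int] by simp
    \<comment> \<open>Both odd squares are 1 modulo 8, so b^2 + c^2 is even. Then b = p + q and c =
      p - q, where p + q is odd because \<open>c\<close> is.\<close>
    have "8 dvd (int s)\<^sup>2 - a\<^sup>2" using square_mod_8[OF abc(1)] square_mod_8[of "int s"] os by (simp add: mod_eq_dvd_iff[symmetric])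
    then obtain k where "(int s)\<^sup>2 - a\<^sup>2 = 8 * k" by blast
    then have "b\<^sup>2 + c\<^sup>2 = 2 * k" using sq by simp
    then have "even (b\<^sup>2 + c\<^sup>2)" by simp
    then have "even (b + c)" "even (b - c)" by auto
    then obtain p q where pq: "b + c = 2 * p" "b - c = 2 * q" by (meson evenE)
    then have b: "b = p + q" "c = p - q" by linarith+
    have "(int s)\<^sup>2 = a\<^sup>2 + 8 * (p\<^sup>2 + q\<^sup>2)" using sq unfolding b by (simp add: power2_eq_square algebra_simps)
    moreover have "odd (p + q)" using abc(2) b by simp
    moreover have "l mod 4 \<noteq> 3" if "prime l" "l dvd s" for l
    proof
      assume "l mod 4 = 3"
      then have "l = 4 * (l div 4) + 3" using mult_div_mod_eq[of 4 l] by simp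
      moreover have "l dvd 4 * n + 5" unfolding s using that(2) by (simp add: power2_eq_square)
      ultimately show False using np that(1) by blast
    qed
    ultimately show False using not_odd_representation os by blast
  qed
next
  assume R: "\<not> (\<exists>m. 4 * n + 5 = m\<^sup>2) \<or> (\<exists>p k. prime p \<and> p dvd 4 * n + 5 \<and> p = 4 * k + 3)"
  define m where "m = 4 * int n + 5"
  have m: "0 < m" "m mod 4 = 1" unfolding m_def by presburger+
  show "\<exists>a b c :: int. odd a \<and> odd c \<and> 4 * int n + 5 = a\<^sup>2 + 4 * b\<^sup>2 + 4 * c\<^sup>2"
  proof (cases "even n")
    case True
    obtain x y z where xyz: "odd x" "m = x\<^sup>2 + (2 * y)\<^sup>2 + (2 * z)\<^sup>2" using three_squares m by blast
    \<comment> \<open>For even \<open>n\<close>, \<open>m\<close> is 5 modulo 8, which leaves no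
      room for y^2 + z^2 even. The odd one of \<open>y\<close>, \<open>z\<close> serves as
      \<open>c\<close>.\<close>
    have "odd (y + z)"
    proof
      assume "even (y + z)"
      then have "even (y\<^sup>2 + z\<^sup>2)" by simp
      then obtain k where "y\<^sup>2 + z\<^sup>2 = 2 * k" by blast
      then have "m = x\<^sup>2 + 8 * k" using xyz(2) by simp
      then have "m mod 8 = 1" using square_mod_8[OF xyz(1)] by simp
      then show False using True unfolding m_def by presburger
    qed
    then consider "odd y" | "odd z" by auto
    then show ?thesis
    proof cases
      case 1
      then show ?thesis using xyz unfolding m_def
        by (intro exI[of _ x] exI[of _ z] exI[of _ y]) simp
    next
      case 2
      then show ?thesis using xyz unfolding m_def
        by (intro exI[of _ x] exI[of _ y] exI[of _ z]) simp
    qed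
  next
    case False
    then have m8: "m mod 8 = 1" unfolding m_def by presburger
    have "\<exists>x p q. m = x\<^sup>2 + 8 * (p\<^sup>2 + q\<^sup>2) \<and> odd (p + q)"
    proof (cases "\<exists>s :: int. m = s\<^sup>2")
      case False
      then show ?thesis using exists_odd_representation[OF m8 m(1)] by simp
    next
      case True
      then obtain s :: int where s: "m = s\<^sup>2" by blast
      have "4 * n + 5 = (nat \<bar>s\<bar>)\<^sup>2"
      proof -
        have "int (4 * n + 5) = int ((nat \<bar>s\<bar>)\<^sup>2)" using s by (simp add: m_def)
        then show ?thesis by (simp only: of_nat_eq_iff)
      qed
      then obtain l k where l: "prime l" "l dvd 4 * n + 5" "l = 4 * k + 3" using R by blast
      have "int l dvd m" using l(2) unfolding m_def by (metis of_nat_add of_nat_mult of_nat_numeral int_dvd_int_iff)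
      then have "int l dvd s" using l(1) unfolding s by (simp add: prime_dvd_power_iff)
      then obtain t where t: "s = int l * t" by blast
      have "odd m" using m(2) by presburger
      then have "odd t" unfolding s t by auto
      have "int l mod 4 = 3" "odd (int l)" unfolding l(3) by simp_all
      moreover have "0 < int l" using l(3) by simp
      moreover have "(int l)\<^sup>2 mod 8 = 1" using square_mod_8 \<open>odd (int l)\<close> by blast
      \<comment> \<open>The square of \<open>l\<close> has the root \<open>l\<close>, which is 3
        modulo 4, so the parity theorem applies to it. Multiplying by the odd cofactor
        \<open>t\<close> keeps p + q odd.\<close>
      ultimately have "\<exists>x p q. (int l)\<^sup>2 = x\<^sup>2 + 8 * (p\<^sup>2 + q\<^sup>2) \<and> odd (p + q)"
        by (intro exists_odd_representation) auto
      then obtain x p q where "(int l)\<^sup>2 = x\<^sup>2 + 8 * (p\<^sup>2 + q\<^sup>2)" "odd (p + q)" by blast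
      then have "m = (t * x)\<^sup>2 + 8 * ((t * p)\<^sup>2 + (t * q)\<^sup>2)" "odd (t * (p + q))"
        using \<open>odd t\<close> unfolding s t by (simp_all add: power_mult_distrib algebra_simps)
      then show ?thesis unfolding distrib_left by blast
    qed
    then obtain x p q where r: "m = x\<^sup>2 + 8 * (p\<^sup>2 + q\<^sup>2)" "odd (p + q)" by blast
    have "odd m" using m(2) by presburger
    then have "odd x" unfolding r(1) by simp
    moreover have "odd (p - q)" using r(2) by simp
    \<comment> \<open>Twice p^2 + q^2 is (p + q)^2 + (p - q)^2, so b = p + q and c = p - q.\<close>
    moreover have "4 * int n + 5 = x\<^sup>2 + 4 * (p + q)\<^sup>2 + 4 * (p - q)\<^sup>2"
      using r(1) unfolding m_def by (simp add: power2_eq_square algebra_simps)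
    ultimately show ?thesis by blast
  qed
qed

end
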